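(* Let $X$ be a Lévy process in $\mathbb{R}$ which is not a compound Poisson process, and assume that $h^\lambda(0)=\lim_{x\to0}h^\lambda(x)=1$ (equivalently, that $0$ is regular for $\{0\}$). Then $\mathcal{K}(X)\subsetneq\mathbb{K}(X)$, $$\mathcal{K}(X)=\Big\{q:\ \lim_{r\to0^+}\sup_{x\in\mathbb{R}}\int_{B(x,r)}|q(z)|\,dz=0\Big\},$$ and $$\mathbb{K}(X)=\Big\{q:\ \sup_{x\in\mathbb{R}}\int_{B(x,1)}|q(z)|\,dz<\infty\Big\}.$$
   Context: All functions $q:\mathbb{R}\to\mathbb{R}$ are Borel. $\mathbb{P}^x,\mathbb{E}^x$ are the law and expectation of $X$ started at $x$; $B(x,r)=(x-r,x+r)$. $T_{\{x\}}=\inf\{t>0:X_t=x\}$ ($\inf\emptyset=\infty$), $h^\lambda(x)=\mathbb{E}^0e^{-\lambda T_{\{x\}}}$ for $\lambda>0$. The point $0$ is regular for $\{0\}$ if $\mathbb{P}^0(T_{\{0\}}=0)=1$. A Lévy process is called compound Poisson if its Gaussian part is zero, its Lévy measure is finite, and its drift $\gamma_0$ is zero (its exponent is $\psi(x)=-\int(e^{ixz}-1)\nu(dz)$ with $\nu$ finite). $\mathbb{K}(X)$ is the set of $q$ with $\lim_{t\to0^+}\sup_x\mathbb{E}^x\int_0^t|q(X_u)|du=0$. $\mathcal{K}(X)$ is the set of $q$ such that for some (equivalently every) $\lambda>0$, $\lim_{r\to0^+}\sup_x\mathbb{E}^x\int_0^\infty e^{-\lambda u}\mathbf 1_{B(x,r)}(X_u)|q(X_u)|du=0$.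 *)

theory Defs
  imports "HOL-Probability.Probability"
begin

text \<open>
  A process is a map \<open>X :: real \<Rightarrow> 'a \<Rightarrow> real\<close>, of which only the times \<open>t \<ge> 0\<close>
  matter. A L\'evy process starts at \<open>0\<close>; its version started at \<open>x\<close> is \<open>\<lambda>t \<omega>. x + X t \<omega>\<close>,
  so \<open>\<P>\<^sup>x\<close> and \<open>\<E>\<^sup>x\<close> are expressed through the single measure \<open>M = \<P>\<^sup>0\<close>.
\<close>

definition cadlag :: "(real \<Rightarrow> real) \<Rightarrow> bool" where
  "cadlag f \<longleftrightarrow>
     (\<forall>t\<ge>0. (f \<longlongrightarrow> f t) (at_right t)) \<and>
     (\<forall>t>0. \<exists>l. (f \<longlongrightarrow> l) (at_left t))"

locale levy_process = prob_space M
  for M :: "'a measure" and X :: "real \<Rightarrow> 'a \<Rightarrow> real" +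
  assumes random_variable_levy: "\<And>t. 0 \<le> t \<Longrightarrow> random_variable borel (X t)"
    and starts_at_0: "AE \<omega> in M. X 0 \<omega> = 0"
    and independent_increments:
      "\<And>(n::nat) (t :: nat \<Rightarrow> real). 0 \<le> t 0 \<Longrightarrow> (\<And>i. i < n \<Longrightarrow> t i < t (Suc i)) \<Longrightarrow>
         indep_vars (\<lambda>_. borel) (\<lambda>i \<omega>. X (t (Suc i)) \<omega> - X (t i) \<omega>) {..<n}"
    and stationary_increments:
      "\<And>s t. 0 \<le> s \<Longrightarrow> 0 \<le> t \<Longrightarrow>
         distr M borel (\<lambda>\<omega>. X (s + t) \<omega> - X s \<omega>) = distr M borel (\<lambda>\<omega>. X t \<omega> - X 0 \<omega>)"
    and stochastically_continuous:
      "\<And>t \<epsilon>. 0 \<le> t \<Longrightarrow> 0 < \<epsilon> \<Longrightarrow>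
         ((\<lambda>s. prob {\<omega> \<in> space M. \<bar>X s \<omega> - X t \<omega>\<bar> > \<epsilon>}) \<longlongrightarrow> 0) (at t within {0..})"
    and cadlag_paths: "AE \<omega> in M. cadlag (\<lambda>t. X t \<omega>)"

definition levy_measure :: "real measure \<Rightarrow> bool" where
  "levy_measure \<nu> \<longleftrightarrow>
     sets \<nu> = sets borel \<and> emeasure \<nu> {0} = 0 \<and>
     (\<integral>\<^sup>+z. ennreal (min 1 (z\<^sup>2)) \<partial>\<nu>) < \<infinity>"

text \<open>The sign convention is \<open>\<E>\<^sup>0 exp (i u X\<^sub>t) = exp (- t \<psi>(u))\<close>.\<close>

definition levy_exponent :: "real \<Rightarrow> real measure \<Rightarrow> real \<Rightarrow> real \<Rightarrow> complex" where
  "levy_exponent A \<nu> \<gamma> u =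
     complex_of_real (A * u\<^sup>2 / 2) - \<i> * complex_of_real (\<gamma> * u)
     - (CLINT z|\<nu>. iexp (u * z) - 1 - \<i> * complex_of_real (u * z * indicator (ball 0 1) z))"

definition levy_triplet ::
    "'a measure \<Rightarrow> (real \<Rightarrow> 'a \<Rightarrow> real) \<Rightarrow> real \<Rightarrow> real measure \<Rightarrow> real \<Rightarrow> bool" where
  "levy_triplet M X A \<nu> \<gamma> \<longleftrightarrow>
     0 \<le> A \<and> levy_measure \<nu> \<and>
     (\<forall>t\<ge>0. \<forall>u. char (distr M borel (X t)) u
        = exp (- complex_of_real t * levy_exponent A \<nu> \<gamma> u))"

text \<open>
  The last conjunct says that the drift \<open>\<gamma>\<^sub>0\<close> vanishes. The measure \<open>\<nu> = 0\<close> is allowed, so the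
  zero process counts as compound Poisson.
\<close>

definition compound_poisson :: "'a measure \<Rightarrow> (real \<Rightarrow> 'a \<Rightarrow> real) \<Rightarrow> bool" where
  "compound_poisson M X \<longleftrightarrow>
     (\<exists>\<nu> \<gamma>. levy_triplet M X 0 \<nu> \<gamma> \<and> finite_measure \<nu> \<and>
        \<gamma> - (LINT z:ball 0 1|\<nu>. z) = 0)"

lemma levy_exponent_finite_no_drift:
  assumes nu: "levy_measure \<nu>" "finite_measure \<nu>"
    and drift: "\<gamma> - (LINT z:ball 0 1|\<nu>. z) = 0"
  shows "levy_exponent 0 \<nu> \<gamma> u = - (CLINT z|\<nu>. iexp (u * z) - 1)"
proof -
  interpret finite_measure \<nu> by fact
  have [measurable_cong]: "sets \<nu> = sets borel"
    using nu(1) by (simp add: levy_measure_def)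
  have 1: "integrable \<nu> (\<lambda>z. iexp (u * z) - 1)"
  proof (rule integrable_const_bound[where B = 2])
    show "AE z in \<nu>. norm (iexp (u * z) - 1) \<le> 2"
    proof (rule AE_I2)
      fix z
      show "norm (iexp (u * z) - 1) \<le> 2"
        using norm_triangle_ineq4[of "iexp (u * z)" 1] by simp
    qed
  qed simp
  have 2: "integrable \<nu> (\<lambda>z::real. z * indicator (ball 0 1) z)"
    by (rule integrable_const_bound[where B = 1]) (auto simp: indicator_def)
  have 3: "integrable \<nu> (\<lambda>z. \<i> * complex_of_real (u * z * indicator (ball 0 1) z))"
  proof -
    have "integrable \<nu> (\<lambda>z::real. u * (z * indicator (ball 0 1) z))"
      by (intro integrable_mult_right impI 2)
    then have "complex_integrable \<nu> (\<lambda>z. complex_of_real (u * (z * indicator (ball 0 1) z)))"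
      by (rule integrable_of_real)
    then show ?thesis
      unfolding mult.assoc by (intro integrable_mult_right impI)
  qed
  have "(CLINT z|\<nu>. \<i> * complex_of_real (u * z * indicator (ball 0 1) z))
      = \<i> * complex_of_real (u * (LINT z|\<nu>. z * indicator (ball 0 1) z))"
    unfolding integral_mult_right_zero integral_complex_of_real mult.assoc ..
  also have "(LINT z|\<nu>. z * indicator (ball 0 1) z) = \<gamma>"
    using drift by (simp add: set_lebesgue_integral_def mult.commute)
  finally show ?thesis
    using 1 3 by (simp add: levy_exponent_def mult.commute)
qed

definition hitting_time :: "(real \<Rightarrow> 'a \<Rightarrow> real) \<Rightarrow> real \<Rightarrow> 'a \<Rightarrow> ereal" where
  "hitting_time X x \<omega> = Inf (ereal ` {t. 0 < t \<and> X t \<omega> = x})"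

definition exp_discount :: "real \<Rightarrow> ereal \<Rightarrow> real" where
  "exp_discount lam T = (if T = \<infinity> then 0 else exp (- lam * real_of_ereal T))"

text \<open>
  Hitting times are in general only measurable with respect to the completion of \<open>M\<close>, and the
  Bochner integral of a non-measurable function is \<open>0\<close> by convention.
\<close>

definition hitting_laplace :: "'a measure \<Rightarrow> (real \<Rightarrow> 'a \<Rightarrow> real) \<Rightarrow> real \<Rightarrow> real \<Rightarrow> real" where
  "hitting_laplace M X lam x =
     (LINT \<omega>|completion M. exp_discount lam (hitting_time X x \<omega>))"

definition kato_time :: "'a measure \<Rightarrow> (real \<Rightarrow> 'a \<Rightarrow> real) \<Rightarrow> (real \<Rightarrow> real) set"
  (* the class written with blackboard bold K *)
  where
  "kato_time M X = {q \<in> borel_measurable borel.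
     ((\<lambda>t. SUP x::real. \<integral>\<^sup>+\<omega>. (\<integral>\<^sup>+u\<in>{0..t}. ennreal \<bar>q (x + X u \<omega>)\<bar> \<partial>lborel) \<partial>M)
       \<longlongrightarrow> 0) (at_right 0)}"

definition kato_space :: "'a measure \<Rightarrow> (real \<Rightarrow> 'a \<Rightarrow> real) \<Rightarrow> (real \<Rightarrow> real) set"
  (* the class written with calligraphic K *)
  where
  "kato_space M X = {q \<in> borel_measurable borel. \<exists>lam>0.
     ((\<lambda>r. SUP x::real. \<integral>\<^sup>+\<omega>.
         (\<integral>\<^sup>+u\<in>{0..}. ennreal (exp (- lam * u) * indicator (ball x r) (x + X u \<omega>)
            * \<bar>q (x + X u \<omega>)\<bar>) \<partial>lborel) \<partial>M)
       \<longlongrightarrow> 0) (at_right 0)}"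

end

theory Submission
  imports Defs
begin

text \<open>
  Let \<open>R\<close> be the resolvent measure of \<open>X\<close> and \<open>U f x = \<integral> f (x + z) dR(z)\<close>. Everything follows from
  the hitting inequality \<open>U f x \<ge> h(y) U f (x + y)\<close>. To prove it without the strong Markov
  property at the hitting time of \<open>y\<close>, apply the Markov property at the first point of a fine time
  grid at which \<open>X\<close> is in a small ball around \<open>y\<close>: by right-continuity this happens, in the limit of
  fine grids, no later than the hitting time of \<open>y\<close>.

  As \<open>h(y) \<rightarrow> 1\<close>, the function \<open>U f\<close> varies at most by a factor \<open>2\<close> on balls of some radius \<open>\<delta>\<close>.
  Averaging \<open>U f (x + y)\<close> over \<open>\<bar>y\<bar> < \<delta>\<close> and using Fubini's theorem compares \<open>U f x\<close> from above and
  from below with integrals of \<open>f\<close> over balls, without ever introducing the resolvent density.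
  This settles the class defined by localization in space. For the class defined by localization
  in time, \<open>U f x = \<E>\<^sup>x \<integral>\<^sub>0\<^sup>t e\<^bsup>-\<lambda>u\<^esup> f(X\<^sub>u) du + e\<^bsup>-\<lambda>t\<^esup> \<E>\<^sup>x U f (X\<^sub>t)\<close>, and the hitting inequality bounds
  the last term from below by \<open>(1 - \<epsilon>(t)) U f x\<close> with \<open>\<epsilon>(t) \<rightarrow> 0\<close>, so that the first
  term is at most \<open>\<epsilon>(t) U f x\<close>. Conversely, if the first term is bounded in \<open>x\<close> then so is \<open>U f\<close>.
\<close>

section \<open>Auxiliary facts\<close>

lemma nn_integral_lborel_shift:
  fixes g :: "real \<Rightarrow> ennreal" and s :: real
  assumes [measurable]: "g \<in> borel_measurable borel"
  shows "(\<integral>\<^sup>+u\<in>{s..}. g u \<partial>lborel) = (\<integral>\<^sup>+u\<in>{0..}. g (s + u) \<partial>lborel)"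
proof -
  have "(\<integral>\<^sup>+u\<in>{s..}. g u \<partial>lborel) = (\<integral>\<^sup>+u. g (s + 1 * u) * indicator {s..} (s + 1 * u) \<partial>lborel)"
    using nn_integral_real_affine[of "\<lambda>u. g u * indicator {s..} u" 1 s] by simp
  also have "\<dots> = (\<integral>\<^sup>+u\<in>{0..}. g (s + u) \<partial>lborel)"
    by (intro nn_integral_cong) (auto simp: indicator_def)
  finally show ?thesis .
qed

lemma nn_integral_exp_Ici:
  assumes "0 < (lam :: real)"
  shows "(\<integral>\<^sup>+u\<in>{0..}. ennreal (exp (- lam * u)) \<partial>lborel) = ennreal (1 / lam)"
proof -
  have "(\<integral>\<^sup>+u. ennreal (exp (- lam * u)) * indicator {0..} u \<partial>lborel) = ennreal (0 - (- exp (- lam * 0) / lam))"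
  proof (rule nn_integral_FTC_atLeast)
    show "((\<lambda>u. - exp (- lam * u) / lam) \<longlongrightarrow> 0) at_top"
      using assms by real_asymp
  qed (use assms in \<open>auto intro!: derivative_eq_intros\<close>)
  then show ?thesis by simp
qed

lemma nn_integral_lborel_translate:
  fixes g :: "real \<Rightarrow> ennreal" and s :: real
  assumes "g \<in> borel_measurable borel"
  shows "(\<integral>\<^sup>+y. g y \<partial>lborel) = (\<integral>\<^sup>+y. g (s + y) \<partial>lborel)"
  using nn_integral_real_affine[OF assms, of 1 s] by simp

lemma ball_real_in_borel [measurable]: "ball (a :: real) r \<in> sets borel"
  by simp

lemma emeasure_lborel_ball_real: "0 \<le> r \<Longrightarrow> emeasure lborel (ball (a :: real) r) = ennreal (2 * r)"
  by (subst ball_eq_greaterThanLessThan) simp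

lemma ennreal_le_divideI:
  assumes "0 < c" "0 \<le> d" "ennreal c * a \<le> ennreal d * b"
  shows "a \<le> ennreal (d / c) * b"
proof -
  have "a = (ennreal (1 / c) * ennreal c) * a"
    using assms(1) by (subst ennreal_mult[symmetric]) simp_all
  also have "\<dots> = ennreal (1 / c) * (ennreal c * a)"
    by (simp only: mult.assoc)
  also have "\<dots> \<le> ennreal (1 / c) * (ennreal d * b)"
    using assms(3) by (intro mult_left_mono) auto
  also have "\<dots> = (ennreal (1 / c) * ennreal d) * b"
    by (simp only: mult.assoc)
  also have "ennreal (1 / c) * ennreal d = ennreal (d / c)"
    using assms by (subst ennreal_mult[symmetric]) simp_all
  finally show ?thesis .
qed

lemma ennreal_tendsto_0I:
  fixes f :: "'b \<Rightarrow> ennreal"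
  assumes "\<And>\<epsilon>. 0 < \<epsilon> \<Longrightarrow> \<forall>\<^sub>F x in F. f x \<le> ennreal \<epsilon>"
  shows "(f \<longlongrightarrow> 0) F"
proof (rule order_tendstoI)
  fix a :: ennreal assume "0 < a"
  then obtain b where b: "0 < b" "b < a" using dense by blast
  then obtain \<epsilon> where "b = ennreal \<epsilon>" "0 < \<epsilon>"
    by (cases b) (auto simp: ennreal_zero_less_mult_iff)
  with assms[of \<epsilon>] show "\<forall>\<^sub>F x in F. f x < a"
    using b(2) by (auto elim!: eventually_mono)
qed simp

lemma tendsto_0_le_cmult_ennreal:
  fixes f g :: "'b \<Rightarrow> ennreal"
  assumes "(g \<longlongrightarrow> 0) F" and "\<forall>\<^sub>F x in F. f x \<le> ennreal K * g x"
  shows "(f \<longlongrightarrow> 0) F"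
proof (rule tendsto_sandwich[where f = "\<lambda>_. 0"])
  have "((\<lambda>x. ennreal K * g x) \<longlongrightarrow> ennreal K * 0) F"
    by (rule ennreal_tendsto_cmult) (simp_all add: assms)
  then show "((\<lambda>x. ennreal K * g x) \<longlongrightarrow> 0) F" by simp
qed (use assms(2) in auto)

text \<open>The term \<open>p * U\<close> is subtracted on both sides, which is legitimate only for
  finite \<open>U\<close>; for infinite \<open>U\<close> the first hypothesis would carry no
  information about \<open>V\<close>.\<close>

lemma ennreal_absorb_le:
  assumes "V + ennreal p * U \<le> U" "U < \<top>" "0 \<le> p"
  shows "V \<le> ennreal (1 - p) * U"
proof -
  obtain u where u: "U = ennreal u" "0 \<le> u"
    using assms(2) by (cases U) auto
  have "V \<le> U"
    by (rule order_trans[OF _ assms(1)]) simp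
  then obtain v where v: "V = ennreal v" "0 \<le> v"
    using u by (cases V) (auto simp: top_unique)
  have "ennreal (v + p * u) \<le> ennreal u"
    using assms u v by (simp add: ennreal_mult)
  then have "v + p * u \<le> u"
    using u by (simp add: ennreal_le_iff)
  then have "v \<le> (1 - p) * u"
    by (simp add: algebra_simps)
  then have "ennreal v \<le> ennreal ((1 - p) * u)"
    by (rule ennreal_leI)
  then show ?thesis
    using u v by (simp add: ennreal_mult'')
qed

lemma ennreal_half_mult_le_iff:
  fixes a b :: ennreal
  shows "ennreal (1 / 2) * a \<le> b \<longleftrightarrow> a \<le> 2 * b"
proof -
  have *: "(2 :: ennreal) * ennreal (1 / 2) = 1"
    using ennreal_mult[of 2 "1 / 2"] by simp
  show ?thesis
  proof
    assume "ennreal (1 / 2) * a \<le> b"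
    then have "2 * (ennreal (1 / 2) * a) \<le> 2 * b" by (intro mult_left_mono) auto
    then show "a \<le> 2 * b" by (simp only: mult.assoc[symmetric] * mult_1)
  next
    assume "a \<le> 2 * b"
    then have "ennreal (1 / 2) * a \<le> ennreal (1 / 2) * (2 * b)" by (intro mult_left_mono) auto
    also have "\<dots> = (2 * ennreal (1 / 2)) * b" by (simp only: ac_simps)
    finally show "ennreal (1 / 2) * a \<le> b" by (simp only: * mult_1)
  qed
qed

lemma hitting_time_nonneg: "0 \<le> hitting_time X y \<omega>"
  unfolding hitting_time_def by (rule Inf_greatest) auto

lemma exp_discount_bounds:
  assumes "0 \<le> T" "0 \<le> lam"
  shows "0 \<le> exp_discount lam T" "exp_discount lam T \<le> 1"
  using assms by (auto simp: exp_discount_def real_of_ereal_pos)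

text \<open>At \<open>T = \<infinity>\<close> both sides are 0 by the default in
  \<open>exp_discount\<close>, and \<open>0 ^ m = 0\<close> is where \<open>0 < m\<close>
  enters.\<close>

lemma exp_discount_power: "0 < m \<Longrightarrow> exp_discount (real m * lam) T = exp_discount lam T ^ m"
  by (simp add: exp_discount_def exp_of_nat_mult[symmetric] ac_simps)

section \<open>The resolvent measure and the Markov property\<close>

context levy_process
begin

text \<open>The set of paths that violate one of the two properties need not be measurable, so a
  null set of \<open>M\<close> covering it is fixed by choice.\<close>

definition bad_paths :: "'a set" where
  "bad_paths = (SOME N. N \<in> null_sets M \<and> (\<forall>\<omega>\<in>space M - N. X 0 \<omega> = 0 \<and> cadlag (\<lambda>t. X t \<omega>)))"

lemma bad_paths:
  "bad_paths \<in> null_sets M"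
  "\<omega> \<in> space M \<Longrightarrow> \<omega> \<notin> bad_paths \<Longrightarrow> X 0 \<omega> = 0"
  "\<omega> \<in> space M \<Longrightarrow> \<omega> \<notin> bad_paths \<Longrightarrow> cadlag (\<lambda>t. X t \<omega>)"
proof -
  have "AE \<omega> in M. X 0 \<omega> = 0 \<and> cadlag (\<lambda>t. X t \<omega>)"
    using starts_at_0 cadlag_paths by auto
  then obtain N where "N \<in> null_sets M" "\<And>\<omega>. \<omega> \<in> space M - N \<Longrightarrow> X 0 \<omega> = 0 \<and> cadlag (\<lambda>t. X t \<omega>)"
    by (rule AE_E3) blast
  then have "\<exists>N. N \<in> null_sets M \<and> (\<forall>\<omega>\<in>space M - N. X 0 \<omega> = 0 \<and> cadlag (\<lambda>t. X t \<omega>))"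
    by blast
  then have *: "bad_paths \<in> null_sets M \<and> (\<forall>\<omega>\<in>space M - bad_paths. X 0 \<omega> = 0 \<and> cadlag (\<lambda>t. X t \<omega>))"
    unfolding bad_paths_def by (rule someI_ex)
  then show "bad_paths \<in> null_sets M"
    by blast
  show "\<omega> \<in> space M \<Longrightarrow> \<omega> \<notin> bad_paths \<Longrightarrow> X 0 \<omega> = 0"
    "\<omega> \<in> space M \<Longrightarrow> \<omega> \<notin> bad_paths \<Longrightarrow> cadlag (\<lambda>t. X t \<omega>)"
    using * by blast+
qed

lemma AE_not_bad: "AE \<omega> in M. \<omega> \<in> space M \<and> \<omega> \<notin> bad_paths"
  using AE_not_in[OF bad_paths(1)] by auto

text \<open>Joint measurability in time and path, which Fubini's theorem needs, may fail for \<open>X\<close> itself, as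
  its paths are cadlag only almost surely and arbitrary at negative times.\<close>

definition cadlag_version :: "real \<Rightarrow> 'a \<Rightarrow> real" where
  "cadlag_version t \<omega> = (if 0 \<le> t \<and> \<omega> \<notin> bad_paths then X t \<omega> else 0)"

lemma AE_cadlag_version: "AE \<omega> in M. \<forall>t\<ge>0. cadlag_version t \<omega> = X t \<omega>"
  using AE_not_bad by eventually_elim (auto simp: cadlag_version_def)

text \<open>Time is rounded up to a grid of mesh \<open>1 / Suc n\<close>. The rounded process is
  jointly measurable because only countably many fixed times occur in it, and by right-continuity it
  converges to the process itself.\<close>

lemma measurable_cadlag_version [measurable]:
  "(\<lambda>(t, \<omega>). cadlag_version t \<omega>) \<in> borel_measurable (lborel \<Otimes>\<^sub>M M)"
proof -
  have [measurable]: "bad_paths \<in> sets M"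
    using bad_paths(1) by auto
  define k where "k n t = \<lfloor>t * real (Suc n)\<rfloor>" for n and t :: real
  \<comment> \<open>The index \<open>i\<close> ranges over all integers; \<open>max 0\<close> keeps
    the time where \<open>X\<close> is known to be measurable.\<close>
  define F where "F n i p = (if 0 \<le> fst p \<and> snd p \<notin> bad_paths
      then X (max 0 ((real_of_int i + 1) / real (Suc n))) (snd p) else 0)" for n :: nat and i :: int and p :: "real \<times> 'a"
  have F[measurable]: "F n i \<in> borel_measurable (lborel \<Otimes>\<^sub>M M)" for n i
  proof -
    have [measurable]: "random_variable borel (X (max 0 ((real_of_int i + 1) / real (Suc n))))"
      by (rule random_variable_levy) simp
    show ?thesis unfolding F_def by measurable
  qed
  have S: "(\<lambda>p. F n (k n (fst p)) p) \<in> borel_measurable (lborel \<Otimes>\<^sub>M M)" for n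
    by (rule measurable_compose_countable[OF F]) (auto simp: k_def)
  show ?thesis
  proof (rule borel_measurable_LIMSEQ_real[OF _ S])
    fix p :: "real \<times> 'a" assume "p \<in> space (lborel \<Otimes>\<^sub>M M)"
    then obtain t \<omega> where p: "p = (t, \<omega>)" "\<omega> \<in> space M"
      by (auto simp: space_pair_measure)
    show "(\<lambda>n. F n (k n (fst p)) p) \<longlonglongrightarrow> (case p of (t, \<omega>) \<Rightarrow> cadlag_version t \<omega>)"
    proof (cases "0 \<le> t \<and> \<omega> \<notin> bad_paths")
      case True
      \<comment> \<open>Floor plus one instead of the ceiling: \<open>s n\<close> has to stay
        strictly above \<open>t\<close>, since the limit \<open>at_right t\<close> leaves out
        \<open>t\<close> itself.\<close>
      define s where "s n = (real_of_int (k n t) + 1) / real (Suc n)" for n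
      have s_gt: "t < s n" for n
      proof -
        have "t * real (Suc n) < real_of_int (k n t) + 1"
          unfolding k_def by linarith
        then show ?thesis unfolding s_def by (simp add: pos_less_divide_eq del: of_nat_Suc)
      qed
      have s_le: "s n \<le> t + 1 / real (Suc n)" for n
      proof -
        have "real_of_int (k n t) + 1 \<le> t * real (Suc n) + 1"
          unfolding k_def by linarith
        then show ?thesis unfolding s_def by (simp add: field_simps del: of_nat_Suc)
      qed
      have "s \<longlonglongrightarrow> t"
      proof (rule tendsto_sandwich)
        show "\<forall>\<^sub>F n in sequentially. t \<le> s n"
          using s_gt by (intro always_eventually allI less_imp_le)
        show "\<forall>\<^sub>F n in sequentially. s n \<le> t + 1 / real (Suc n)"
          using s_le by (intro always_eventually allI)
        show "(\<lambda>n. t + 1 / real (Suc n)) \<longlonglongrightarrow> t"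
          using tendsto_add[OF tendsto_const LIMSEQ_inverse_real_of_nat, of t] by (simp add: inverse_eq_divide)
      qed simp
      then have "filterlim s (at_right t) sequentially"
        using s_gt by (auto simp: filterlim_at less_imp_neq[THEN not_sym])
      moreover have "((\<lambda>t. X t \<omega>) \<longlongrightarrow> X t \<omega>) (at_right t)"
        using bad_paths(3) True p unfolding cadlag_def by auto
      ultimately have "(\<lambda>n. X (s n) \<omega>) \<longlonglongrightarrow> X t \<omega>"
        by (rule filterlim_compose[rotated])
      moreover have "F n (k n (fst p)) p = X (s n) \<omega>" for n
        using True s_gt[of n] by (simp add: F_def p s_def max_def del: of_nat_Suc)
      ultimately show ?thesis
        using True by (simp add: p cadlag_version_def)
    qed (auto simp: p F_def cadlag_version_def)
  qed
qed

lemma measurable_cadlag_version' [measurable (raw)]: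
  assumes [measurable]: "f \<in> borel_measurable N" "g \<in> measurable N M"
  shows "(\<lambda>x. cadlag_version (f x) (g x)) \<in> borel_measurable N"
proof -
  have "(\<lambda>x. (f x, g x)) \<in> measurable N (lborel \<Otimes>\<^sub>M M)"
    by measurable
  from measurable_compose[OF this measurable_cadlag_version] show ?thesis
    by simp
qed

text \<open>A set is given the expected discounted time that \<open>X\<close> spends in it. Written
  as an image measure it is a measure by construction, and its integrals reduce to Fubini's theorem
  for \<open>lborel\<close> and \<open>M\<close>.\<close>

definition resolvent_measure :: "real \<Rightarrow> real measure" where
  "resolvent_measure lam = distr
     (density (lborel \<Otimes>\<^sub>M M) (\<lambda>(u, \<omega>). ennreal (exp (- lam * u)) * indicator {0..} u)) borel
     (\<lambda>(u, \<omega>). cadlag_version u \<omega>)"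

lemma sets_resolvent_measure [measurable_cong, simp]: "sets (resolvent_measure lam) = sets borel"
  and space_resolvent_measure [simp]: "space (resolvent_measure lam) = UNIV"
  by (simp_all add: resolvent_measure_def)

lemma nn_integral_resolvent_measure_prod:
  assumes [measurable]: "f \<in> borel_measurable borel"
  shows "(\<integral>\<^sup>+z. f z \<partial>resolvent_measure lam) = (\<integral>\<^sup>+(u, \<omega>). ennreal (exp (- lam * u)) * indicator {0..} u
     * f (cadlag_version u \<omega>) \<partial>(lborel \<Otimes>\<^sub>M M))"
  unfolding resolvent_measure_def
  by (subst nn_integral_distr, simp, simp, subst nn_integral_density)
     (auto simp: split_beta' intro!: nn_integral_cong)

lemma nn_integral_resolvent_measure_version:
  assumes [measurable]: "f \<in> borel_measurable borel"
  shows "(\<integral>\<^sup>+z. f z \<partial>resolvent_measure lam) = (\<integral>\<^sup>+u. ennreal (exp (- lam * u)) * indicator {0..} u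
     * (\<integral>\<^sup>+\<omega>. f (cadlag_version u \<omega>) \<partial>M) \<partial>lborel)"
  unfolding nn_integral_resolvent_measure_prod[OF assms]
  by (subst nn_integral_fst[symmetric], simp) (simp add: nn_integral_cmult)

lemma nn_integral_resolvent_measure:
  assumes [measurable]: "f \<in> borel_measurable borel"
  shows "(\<integral>\<^sup>+z. f z \<partial>resolvent_measure lam)
    = (\<integral>\<^sup>+u\<in>{0..}. ennreal (exp (- lam * u)) * (\<integral>\<^sup>+\<omega>. f (X u \<omega>) \<partial>M) \<partial>lborel)"
  unfolding nn_integral_resolvent_measure_version[OF assms]
proof (rule nn_integral_cong)
  fix u :: real
  have "(\<integral>\<^sup>+\<omega>. f (cadlag_version u \<omega>) \<partial>M) = (\<integral>\<^sup>+\<omega>. f (X u \<omega>) \<partial>M)" if "0 \<le> u"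
    by (rule nn_integral_cong_AE) (use AE_cadlag_version that in auto)
  then show "ennreal (exp (- lam * u)) * indicator {0..} u * (\<integral>\<^sup>+\<omega>. f (cadlag_version u \<omega>) \<partial>M)
    = ennreal (exp (- lam * u)) * (\<integral>\<^sup>+\<omega>. f (X u \<omega>) \<partial>M) * indicator {0..} u"
    by (simp add: indicator_def)
qed

text \<open>Time runs inside the path integral here, so the exceptional null set must serve all
  times at once; \<open>AE_cadlag_version\<close> provides that.\<close>

lemma nn_integral_resolvent_measure_swap:
  assumes [measurable]: "f \<in> borel_measurable borel"
  shows "(\<integral>\<^sup>+z. f z \<partial>resolvent_measure lam)
    = (\<integral>\<^sup>+\<omega>. (\<integral>\<^sup>+u\<in>{0..}. ennreal (exp (- lam * u)) * f (X u \<omega>) \<partial>lborel) \<partial>M)"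
proof -
  interpret pair_sigma_finite lborel M ..
  show ?thesis
    unfolding nn_integral_resolvent_measure_prod[OF assms]
  proof (subst nn_integral_snd[symmetric], simp, rule nn_integral_cong_AE)
    show "AE \<omega> in M. (\<integral>\<^sup>+u. (case (u, \<omega>) of (u, \<omega>) \<Rightarrow> ennreal (exp (- lam * u)) * indicator {0..} u
         * f (cadlag_version u \<omega>)) \<partial>lborel)
      = (\<integral>\<^sup>+u\<in>{0..}. ennreal (exp (- lam * u)) * f (X u \<omega>) \<partial>lborel)"
      using AE_cadlag_version
      by eventually_elim (auto intro!: nn_integral_cong simp: indicator_def)
  qed
qed

text \<open>The history up to time \<open>j * d\<close> is recorded by increments rather than
  positions, because independence is assumed for increments; partial sums recover the positions once
  \<open>X 0 \<omega> = 0\<close>. The restriction makes the history a point of a product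
  space.\<close>

abbreviation grid_increments :: "nat \<Rightarrow> real \<Rightarrow> 'a \<Rightarrow> nat \<Rightarrow> real" where
  "grid_increments j d \<omega> \<equiv> (\<lambda>i\<in>{..<j}. X (real (Suc i) * d) \<omega> - X (real i * d) \<omega>)"

lemma measurable_grid_increments:
  assumes "0 < d"
  shows "grid_increments j d \<in> measurable M (PiM {..<j} (\<lambda>_. borel))"
proof (rule measurable_restrict)
  fix i
  have [measurable]: "random_variable borel (X (real (Suc i) * d))" "random_variable borel (X (real i * d))"
    using assms by (auto intro!: random_variable_levy)
  show "random_variable borel (\<lambda>\<omega>. X (real (Suc i) * d) \<omega> - X (real i * d) \<omega>)"
    by measurable
qed

lemma sum_grid_increments:
  "i \<le> j \<Longrightarrow> (\<Sum>l<i. grid_increments j d \<omega> l) = X (real i * d) \<omega> - X 0 \<omega>"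
proof -
  assume "i \<le> j"
  then have "(\<Sum>l<i. grid_increments j d \<omega> l) = (\<Sum>l<i. X (real (Suc l) * d) \<omega> - X (real l * d) \<omega>)"
    by (intro sum.cong) simp_all
  also have "\<dots> = X (real i * d) \<omega> - X 0 \<omega>"
    by (subst sum_lessThan_telescope[of "\<lambda>l. X (real l * d) \<omega>" i]) simp
  finally show ?thesis .
qed

text \<open>The increment over \<open>[j * d, j * d + u]\<close> is independent of the earlier ones
  and, by stationarity, distributed like \<open>X u\<close>. The joint law of past and future is
  therefore a product, and the future can be integrated out first, over a fresh copy of the
  process.\<close>

lemma markov:
  assumes [measurable]: "\<Phi> \<in> borel_measurable (PiM {..<j} (\<lambda>_. borel))" "f \<in> borel_measurable borel"
    and d: "0 < d" and u: "0 \<le> u"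
  shows "(\<integral>\<^sup>+\<omega>. \<Phi> (grid_increments j d \<omega>) * f (X (real j * d + u) \<omega>) \<partial>M)
    = (\<integral>\<^sup>+\<omega>. \<Phi> (grid_increments j d \<omega>) * (\<integral>\<^sup>+w. f (X (real j * d) \<omega> + X u w) \<partial>M) \<partial>M)"
\<comment> \<open>Independence is assumed for strictly increasing times only, so an empty future
  increment is treated separately.\<close>
proof (cases "u = 0")
  case True
  have "(\<integral>\<^sup>+w. f (x + X 0 w) \<partial>M) = f x" for x
  proof -
    have "(\<integral>\<^sup>+w. f (x + X 0 w) \<partial>M) = (\<integral>\<^sup>+w. f x \<partial>M)"
      by (rule nn_integral_cong_AE) (use starts_at_0 in auto)
    then show ?thesis by (simp add: emeasure_space_1)
  qed
  with True show ?thesis by simp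
next
  case False
  with u have u: "0 < u" by simp
  \<comment> \<open>These times make the past increments the members below \<open>j\<close>, and the
    future increment the member \<open>j\<close>, of one independent family.\<close>
  define t where "t i = (if i \<le> j then real i * d else real j * d + u)" for i
  define I where "I i \<omega> = X (t (Suc i)) \<omega> - X (t i) \<omega>" for i \<omega>
  let ?S = "PiM {..<j} (\<lambda>_. borel :: real measure)"
  let ?T = "PiM {j} (\<lambda>_. borel :: real measure)"
  let ?F = "grid_increments j d"
  let ?G = "\<lambda>\<omega>. restrict (\<lambda>i. I i \<omega>) {j}"
  have F_eq: "(\<lambda>\<omega>. restrict (\<lambda>i. I i \<omega>) {..<j}) = ?F"
    by (auto simp: I_def t_def fun_eq_iff restrict_def)
  have Ij: "I j = (\<lambda>\<omega>. X (real j * d + u) \<omega> - X (real j * d) \<omega>)"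
    by (auto simp: I_def t_def)
  have "indep_vars (\<lambda>_. borel) I {..<Suc j}"
    unfolding I_def[abs_def]
    by (rule independent_increments) (use d u in \<open>auto simp: t_def not_le less_Suc_eq algebra_simps\<close>)
  then have "indep_var ?S ?F ?T ?G"
    unfolding F_eq[symmetric] by (rule indep_var_restrict) auto
  then have [measurable]: "?F \<in> measurable M ?S" "?G \<in> measurable M ?T"
    and prod: "distr M ?S ?F \<Otimes>\<^sub>M distr M ?T ?G = distr M (?S \<Otimes>\<^sub>M ?T) (\<lambda>\<omega>. (?F \<omega>, ?G \<omega>))"
    by (auto simp only: indep_var_distribution_eq)
  have [measurable]: "random_variable borel (I j)"
    unfolding Ij using d u by (intro borel_measurable_diff random_variable_levy) auto
  have [measurable]: "random_variable borel (X u)" "random_variable borel (X 0)"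
    using u by (auto intro!: random_variable_levy)
  interpret Ij: prob_space "distr M ?T ?G"
    by (rule prob_space_distr) simp
  have law: "(\<integral>\<^sup>+b. g (b j) \<partial>distr M ?T ?G) = (\<integral>\<^sup>+w. g (X u w) \<partial>M)"
    if [measurable]: "g \<in> borel_measurable borel" for g
  proof -
    have [measurable]: "(\<lambda>b. b j) \<in> borel_measurable ?T"
      by measurable
    have "(\<integral>\<^sup>+b. g (b j) \<partial>distr M ?T ?G) = (\<integral>\<^sup>+b. g b \<partial>distr M borel (I j))"
      by (simp add: nn_integral_distr)
    also have "distr M borel (I j) = distr M borel (\<lambda>\<omega>. X u \<omega> - X 0 \<omega>)"
      unfolding Ij by (rule stationary_increments) (use d u in auto)
    also have "(\<integral>\<^sup>+b. g b \<partial>\<dots>) = (\<integral>\<^sup>+w. g (X u w - X 0 w) \<partial>M)"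
      by (rule nn_integral_distr) auto
    also have "\<dots> = (\<integral>\<^sup>+w. g (X u w) \<partial>M)"
      by (rule nn_integral_cong_AE) (use starts_at_0 in auto)
    finally show ?thesis .
  qed
  have X_j: "AE \<omega> in M. (\<Sum>l<j. ?F \<omega> l) = X (real j * d) \<omega>"
    using starts_at_0
  proof eventually_elim
    case (elim \<omega>)
    then show ?case
      using sum_grid_increments[of j j d \<omega>] by simp
  qed
  have [measurable]: "(\<lambda>a. \<Sum>l<j. a l) \<in> borel_measurable ?S" "(\<lambda>b. b j) \<in> borel_measurable ?T"
    by measurable
  have "(\<integral>\<^sup>+\<omega>. \<Phi> (?F \<omega>) * f (X (real j * d + u) \<omega>) \<partial>M)
    = (\<integral>\<^sup>+\<omega>. (\<lambda>(a, b). \<Phi> a * f ((\<Sum>l<j. a l) + b j)) (?F \<omega>, ?G \<omega>) \<partial>M)"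
    by (rule nn_integral_cong_AE) (use X_j in \<open>auto simp: Ij\<close>)
  also have "\<dots> = (\<integral>\<^sup>+p. (\<lambda>(a, b). \<Phi> a * f ((\<Sum>l<j. a l) + b j)) p \<partial>(distr M ?S ?F \<Otimes>\<^sub>M distr M ?T ?G))"
    unfolding prod by (rule nn_integral_distr[symmetric]) measurable
  also have "\<dots> = (\<integral>\<^sup>+a. \<integral>\<^sup>+b. \<Phi> a * f ((\<Sum>l<j. a l) + b j) \<partial>distr M ?T ?G \<partial>distr M ?S ?F)"
    by (subst Ij.nn_integral_fst[symmetric]) simp_all
  also have "\<dots> = (\<integral>\<^sup>+\<omega>. \<integral>\<^sup>+b. \<Phi> (?F \<omega>) * f ((\<Sum>l<j. ?F \<omega> l) + b j) \<partial>distr M ?T ?G \<partial>M)"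
    by (rule nn_integral_distr) measurable
  also have "\<dots> = (\<integral>\<^sup>+\<omega>. \<Phi> (?F \<omega>) * (\<integral>\<^sup>+w. f (X (real j * d) \<omega> + X u w) \<partial>M) \<partial>M)"
  proof (rule nn_integral_cong_AE, use X_j in eventually_elim)
    case (elim \<omega>)
    then show ?case
      using law[of "\<lambda>b. f (X (real j * d) \<omega> + b)"] by (simp add: nn_integral_cmult del: restrict_apply)
  qed
  finally show ?thesis .
qed

text \<open>This is \<open>markov\<close> integrated over \<open>u\<close> with the discount.
  Shifting time by \<open>s\<close> brings out the factor \<open>exp (- lam * s)\<close>, and
  Fubini's theorem, applied to \<open>cadlag_version\<close>, reassembles the rest into an integral
  over the resolvent measure.\<close>

lemma resolvent_markov:
  assumes \<Phi>[measurable]: "\<Phi> \<in> borel_measurable (PiM {..<j} (\<lambda>_. borel))"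
    and f[measurable]: "f \<in> borel_measurable borel" and d: "0 < d" and s: "s = real j * d"
  shows "(\<integral>\<^sup>+\<omega>. \<Phi> (grid_increments j d \<omega>)
        * (\<integral>\<^sup>+u\<in>{s..}. ennreal (exp (- lam * u)) * f (X u \<omega>) \<partial>lborel) \<partial>M)
    = ennreal (exp (- lam * s))
        * (\<integral>\<^sup>+\<omega>. \<Phi> (grid_increments j d \<omega>) * (\<integral>\<^sup>+z. f (X s \<omega> + z) \<partial>resolvent_measure lam) \<partial>M)"
    (is "?L = ?R")
proof -
  interpret pair_sigma_finite lborel M ..
  let ?F = "grid_increments j d"
  let ?Y = cadlag_version
  have s0: "0 \<le> s" using d s by simp
  have [measurable]: "?F \<in> measurable M (PiM {..<j} (\<lambda>_. borel))"
    using d by (rule measurable_grid_increments)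
  have [measurable]: "random_variable borel (X s)"
    using s0 by (rule random_variable_levy)
  have *: "(\<integral>\<^sup>+\<omega>. \<Phi> (?F \<omega>) * f (?Y (s + u) \<omega>) \<partial>M)
      = (\<integral>\<^sup>+\<omega>. \<Phi> (?F \<omega>) * (\<integral>\<^sup>+w. f (X s \<omega> + ?Y u w) \<partial>M) \<partial>M)" if "0 \<le> u" for u
  proof -
    have "(\<integral>\<^sup>+\<omega>. \<Phi> (?F \<omega>) * f (?Y (s + u) \<omega>) \<partial>M) = (\<integral>\<^sup>+\<omega>. \<Phi> (?F \<omega>) * f (X (s + u) \<omega>) \<partial>M)"
      by (rule nn_integral_cong_AE) (use AE_cadlag_version that s0 in auto)
    also have "\<dots> = (\<integral>\<^sup>+\<omega>. \<Phi> (?F \<omega>) * (\<integral>\<^sup>+w. f (X s \<omega> + X u w) \<partial>M) \<partial>M)"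
      unfolding s by (rule markov) (use d that in auto)
    also have "(\<lambda>\<omega>. \<integral>\<^sup>+w. f (X s \<omega> + X u w) \<partial>M) = (\<lambda>\<omega>. \<integral>\<^sup>+w. f (X s \<omega> + ?Y u w) \<partial>M)"
      by (rule ext, rule nn_integral_cong_AE) (use AE_cadlag_version that in auto)
    finally show ?thesis .
  qed
  have "?L = (\<integral>\<^sup>+\<omega>. \<Phi> (?F \<omega>) * (\<integral>\<^sup>+u\<in>{s..}. ennreal (exp (- lam * u)) * f (?Y u \<omega>) \<partial>lborel) \<partial>M)"
    by (rule nn_integral_cong_AE, use AE_cadlag_version in eventually_elim)
       (use s0 in \<open>auto intro!: arg_cong[where f = "\<lambda>x. _ * x"] nn_integral_cong simp: indicator_def\<close>)
  also have "\<dots> = (\<integral>\<^sup>+\<omega>. \<Phi> (?F \<omega>)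
      * (\<integral>\<^sup>+u\<in>{0..}. ennreal (exp (- lam * (s + u))) * f (?Y (s + u) \<omega>) \<partial>lborel) \<partial>M)"
    by (intro nn_integral_cong, subst nn_integral_lborel_shift) simp_all
  also have "\<dots> = (\<integral>\<^sup>+\<omega>. \<integral>\<^sup>+u. \<Phi> (?F \<omega>)
      * (ennreal (exp (- lam * (s + u))) * f (?Y (s + u) \<omega>) * indicator {0..} u) \<partial>lborel \<partial>M)"
    by (intro nn_integral_cong nn_integral_cmult[symmetric]) measurable
  also have "\<dots> = (\<integral>\<^sup>+u. \<integral>\<^sup>+\<omega>. \<Phi> (?F \<omega>)
      * (ennreal (exp (- lam * (s + u))) * f (?Y (s + u) \<omega>) * indicator {0..} u) \<partial>M \<partial>lborel)"
    by (rule Fubini') measurable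
  also have "\<dots> = (\<integral>\<^sup>+u. ennreal (exp (- lam * (s + u))) * indicator {0..} u
      * (\<integral>\<^sup>+\<omega>. \<Phi> (?F \<omega>) * f (?Y (s + u) \<omega>) \<partial>M) \<partial>lborel)"
    by (intro nn_integral_cong, subst nn_integral_cmult[symmetric], measurable)
       (auto intro!: nn_integral_cong simp: ac_simps)
  also have "\<dots> = (\<integral>\<^sup>+u. ennreal (exp (- lam * (s + u))) * indicator {0..} u
      * (\<integral>\<^sup>+\<omega>. \<Phi> (?F \<omega>) * (\<integral>\<^sup>+w. f (X s \<omega> + ?Y u w) \<partial>M) \<partial>M) \<partial>lborel)"
    by (intro nn_integral_cong) (auto simp: indicator_def * simp del: of_nat_Suc)
  also have "\<dots> = (\<integral>\<^sup>+u. ennreal (exp (- lam * s)) * (\<integral>\<^sup>+\<omega>. \<Phi> (?F \<omega>) *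
      (ennreal (exp (- lam * u)) * indicator {0..} u * (\<integral>\<^sup>+w. f (X s \<omega> + ?Y u w) \<partial>M)) \<partial>M) \<partial>lborel)"
  proof (rule nn_integral_cong)
    fix u
    have "ennreal (exp (- lam * (s + u))) = ennreal (exp (- lam * s)) * ennreal (exp (- lam * u))"
      by (simp add: ennreal_mult'[symmetric] exp_add[symmetric] algebra_simps)
    moreover have "(\<integral>\<^sup>+\<omega>. \<Phi> (?F \<omega>) * (ennreal (exp (- lam * u)) * indicator {0..} u
          * (\<integral>\<^sup>+w. f (X s \<omega> + ?Y u w) \<partial>M)) \<partial>M)
        = (\<integral>\<^sup>+\<omega>. (ennreal (exp (- lam * u)) * indicator {0..} u)
          * (\<Phi> (?F \<omega>) * (\<integral>\<^sup>+w. f (X s \<omega> + ?Y u w) \<partial>M)) \<partial>M)"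
      by (rule nn_integral_cong) (simp only: mult_ac)
    moreover have "\<dots> = (ennreal (exp (- lam * u)) * indicator {0..} u)
        * (\<integral>\<^sup>+\<omega>. \<Phi> (?F \<omega>) * (\<integral>\<^sup>+w. f (X s \<omega> + ?Y u w) \<partial>M) \<partial>M)"
      by (rule nn_integral_cmult) measurable
    ultimately show "ennreal (exp (- lam * (s + u))) * indicator {0..} u
        * (\<integral>\<^sup>+\<omega>. \<Phi> (?F \<omega>) * (\<integral>\<^sup>+w. f (X s \<omega> + ?Y u w) \<partial>M) \<partial>M)
      = ennreal (exp (- lam * s)) * (\<integral>\<^sup>+\<omega>. \<Phi> (?F \<omega>) *
        (ennreal (exp (- lam * u)) * indicator {0..} u * (\<integral>\<^sup>+w. f (X s \<omega> + ?Y u w) \<partial>M)) \<partial>M)"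
      by (simp only: mult.assoc)
  qed
  also have "\<dots> = ennreal (exp (- lam * s)) * (\<integral>\<^sup>+u. (\<integral>\<^sup>+\<omega>. \<Phi> (?F \<omega>) *
      (ennreal (exp (- lam * u)) * indicator {0..} u * (\<integral>\<^sup>+w. f (X s \<omega> + ?Y u w) \<partial>M)) \<partial>M) \<partial>lborel)"
    by (rule nn_integral_cmult) measurable
  also have "(\<integral>\<^sup>+u. (\<integral>\<^sup>+\<omega>. \<Phi> (?F \<omega>) *
      (ennreal (exp (- lam * u)) * indicator {0..} u * (\<integral>\<^sup>+w. f (X s \<omega> + ?Y u w) \<partial>M)) \<partial>M) \<partial>lborel)
    = (\<integral>\<^sup>+\<omega>. (\<integral>\<^sup>+u. \<Phi> (?F \<omega>) *
      (ennreal (exp (- lam * u)) * indicator {0..} u * (\<integral>\<^sup>+w. f (X s \<omega> + ?Y u w) \<partial>M)) \<partial>lborel) \<partial>M)"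
    by (rule Fubini'[symmetric]) measurable
  also have "\<dots> = (\<integral>\<^sup>+\<omega>. \<Phi> (?F \<omega>) * (\<integral>\<^sup>+z. f (X s \<omega> + z) \<partial>resolvent_measure lam) \<partial>M)"
  proof (rule nn_integral_cong)
    fix \<omega>
    have "(\<integral>\<^sup>+z. f (X s \<omega> + z) \<partial>resolvent_measure lam) = (\<integral>\<^sup>+u.
      (ennreal (exp (- lam * u)) * indicator {0..} u * (\<integral>\<^sup>+w. f (X s \<omega> + ?Y u w) \<partial>M)) \<partial>lborel)"
      by (rule nn_integral_resolvent_measure_version) simp
    then show "(\<integral>\<^sup>+u. \<Phi> (?F \<omega>) *
      (ennreal (exp (- lam * u)) * indicator {0..} u * (\<integral>\<^sup>+w. f (X s \<omega> + ?Y u w) \<partial>M)) \<partial>lborel)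
      = \<Phi> (?F \<omega>) * (\<integral>\<^sup>+z. f (X s \<omega> + z) \<partial>resolvent_measure lam)"
      by (simp add: nn_integral_cmult)
  qed
  finally show ?thesis .
qed

section \<open>The hitting inequality\<close>

lemma emeasure_resolvent_measure_UNIV:
  assumes "0 < lam"
  shows "emeasure (resolvent_measure lam) UNIV = ennreal (1 / lam)"
proof -
  have "emeasure (resolvent_measure lam) UNIV = (\<integral>\<^sup>+z. 1 \<partial>resolvent_measure lam)"
    by simp
  also have "\<dots> = ennreal (1 / lam)"
    by (subst nn_integral_resolvent_measure) (simp_all add: emeasure_space_1 nn_integral_exp_Ici[OF assms, simplified])
  finally show ?thesis .
qed

section \<open>First visits to a set along a time grid\<close>

definition first_visit :: "real \<Rightarrow> real set \<Rightarrow> nat \<Rightarrow> 'a set" where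
  "first_visit d B j = {\<omega> \<in> space M. X (real j * d) \<omega> \<in> B \<and> (\<forall>i<j. X (real i * d) \<omega> \<notin> B)}"

lemma sets_first_visit [measurable]:
  assumes "0 < d" and [measurable]: "B \<in> sets borel"
  shows "first_visit d B j \<in> sets M"
proof -
  have [measurable]: "random_variable borel (X (real i * d))" for i
    using assms by (auto intro!: random_variable_levy)
  show ?thesis unfolding first_visit_def by measurable
qed

lemma disjoint_first_visit: "disjoint_family (first_visit d B)"
proof (unfold disjoint_family_on_def, intro ballI impI equals0I)
  fix i j \<omega> assume "i \<noteq> j" "\<omega> \<in> first_visit d B i \<inter> first_visit d B j"
  then show False
    by (cases i j rule: linorder_cases) (auto simp: first_visit_def)
qed

text \<open>With \<open>T\<close> the first grid time at which \<open>X\<close> lies in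
  \<open>B\<close>, this is \<open>exp (- lam * T)\<close>, and 0 if there is no such time, because
  the events \<open>first_visit d B j\<close> are disjoint in \<open>j\<close>.\<close>

definition grid_discount :: "real \<Rightarrow> real \<Rightarrow> real set \<Rightarrow> 'a \<Rightarrow> ennreal" where
  "grid_discount lam d B \<omega> = (\<Sum>j. ennreal (exp (- lam * (real j * d))) * indicator (first_visit d B j) \<omega>)"

text \<open>This is the strong Markov property at a random time with values in the grid: the Markov
  property is used on each event \<open>first_visit d B j\<close>, and disjointness lets the
  contributions add up to at most the whole integral.\<close>

lemma resolvent_ge_grid_discount:
  assumes [measurable]: "B \<in> sets borel" "f \<in> borel_measurable borel" and d: "0 < d"
    and c: "\<And>x. x \<in> B \<Longrightarrow> c \<le> (\<integral>\<^sup>+z. f (x + z) \<partial>resolvent_measure lam)"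
  shows "c * (\<integral>\<^sup>+\<omega>. grid_discount lam d B \<omega> \<partial>M) \<le> (\<integral>\<^sup>+z. f z \<partial>resolvent_measure lam)"
proof -
  let ?V = "first_visit d B"
  define W where "W \<omega> = (\<integral>\<^sup>+u\<in>{0..}. ennreal (exp (- lam * u)) * f (cadlag_version u \<omega>) \<partial>lborel)" for \<omega>
  have W_AE: "AE \<omega> in M. W \<omega> = (\<integral>\<^sup>+u\<in>{0..}. ennreal (exp (- lam * u)) * f (X u \<omega>) \<partial>lborel)"
    using AE_cadlag_version unfolding W_def
    by eventually_elim (auto intro!: nn_integral_cong simp: indicator_def)
  have [measurable]: "?V j \<in> sets M" for j
    using d by measurable
  have [measurable]: "W \<in> borel_measurable M"
    unfolding W_def by measurable
  have step: "c * (ennreal (exp (- lam * (real j * d))) * emeasure M (?V j)) \<le> (\<integral>\<^sup>+\<omega>. indicator (?V j) \<omega> * W \<omega> \<partial>M)" for j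
  proof -
    let ?S = "PiM {..<j} (\<lambda>_. borel :: real measure)"
    \<comment> \<open>The first visit at step \<open>j\<close>, expressed through partial sums of
      increments so that \<open>resolvent_markov\<close> applies.\<close>
    define \<Phi> :: "(nat \<Rightarrow> real) \<Rightarrow> ennreal" where
      "\<Phi> = indicator {a \<in> space ?S. (\<Sum>l<j. a l) \<in> B \<and> (\<forall>i<j. (\<Sum>l<i. a l) \<notin> B)}"
    have [measurable]: "(\<lambda>a. \<Sum>l<i. a l) \<in> borel_measurable ?S" if "i \<le> j" for i
      using that by (intro borel_measurable_sum) auto
    have [measurable]: "\<Phi> \<in> borel_measurable ?S"
    proof -
      have "{a \<in> space ?S. (\<Sum>l<j. a l) \<in> B \<and> (\<forall>i\<in>{..<j}. (\<Sum>l<i. a l) \<notin> B)} \<in> sets ?S"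
        by measurable
      then show ?thesis unfolding \<Phi>_def by (auto simp: lessThan_def)
    qed
    have \<Phi>_AE: "AE \<omega> in M. \<Phi> (grid_increments j d \<omega>) = indicator (?V j) \<omega>"
      using starts_at_0 AE_space
    proof eventually_elim
      case (elim \<omega>)
      have "grid_increments j d \<omega> \<in> space ?S"
        using measurable_grid_increments[OF d, of j] elim by (auto simp: measurable_def)
      moreover have "(\<Sum>l<i. grid_increments j d \<omega> l) = X (real i * d) \<omega>" if "i \<le> j" for i
        using sum_grid_increments[OF that, of d \<omega>] elim by simp
      ultimately show ?case
        using elim by (simp add: \<Phi>_def first_visit_def indicator_def del: restrict_apply)
    qed
    let ?e = "ennreal (exp (- lam * (real j * d)))"
    have "c * (?e * emeasure M (?V j)) = ?e * (\<integral>\<^sup>+\<omega>. indicator (?V j) \<omega> * c \<partial>M)"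
      by (subst nn_integral_multc) (auto simp: ac_simps)
    also have "\<dots> \<le> ?e * (\<integral>\<^sup>+\<omega>. indicator (?V j) \<omega> * (\<integral>\<^sup>+z. f (X (real j * d) \<omega> + z) \<partial>resolvent_measure lam) \<partial>M)"
      by (rule mult_left_mono[OF nn_integral_mono]) (auto simp: indicator_def first_visit_def intro: c)
    also have "\<dots> = ?e * (\<integral>\<^sup>+\<omega>. \<Phi> (grid_increments j d \<omega>) * (\<integral>\<^sup>+z. f (X (real j * d) \<omega> + z) \<partial>resolvent_measure lam) \<partial>M)"
      by (rule arg_cong[where f = "\<lambda>x. ?e * x"], rule nn_integral_cong_AE, use \<Phi>_AE in eventually_elim) simp
    also have "\<dots> = (\<integral>\<^sup>+\<omega>. \<Phi> (grid_increments j d \<omega>)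
        * (\<integral>\<^sup>+u\<in>{real j * d..}. ennreal (exp (- lam * u)) * f (X u \<omega>) \<partial>lborel) \<partial>M)"
      by (rule resolvent_markov[symmetric]) (use d in auto)
    \<comment> \<open>Adding the time before \<open>j * d\<close> only increases the integral, and
      it makes the time integral the same for every \<open>j\<close>.\<close>
    also have "\<dots> \<le> (\<integral>\<^sup>+\<omega>. \<Phi> (grid_increments j d \<omega>)
        * (\<integral>\<^sup>+u\<in>{0..}. ennreal (exp (- lam * u)) * f (X u \<omega>) \<partial>lborel) \<partial>M)"
    proof (rule nn_integral_mono, rule mult_left_mono, rule nn_integral_mono)
      have "0 \<le> real j * d" using d by simp
      then show "ennreal (exp (- lam * u)) * f (X u \<omega>) * indicator {real j * d..} u
        \<le> ennreal (exp (- lam * u)) * f (X u \<omega>) * indicator {0..} u" for u \<omega>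
        by (simp add: indicator_def)
    qed simp
    also have "\<dots> = (\<integral>\<^sup>+\<omega>. indicator (?V j) \<omega> * W \<omega> \<partial>M)"
      by (rule nn_integral_cong_AE, use \<Phi>_AE W_AE in eventually_elim) simp
    finally show ?thesis .
  qed
  have "c * (\<integral>\<^sup>+\<omega>. grid_discount lam d B \<omega> \<partial>M)
      = c * (\<Sum>j. ennreal (exp (- lam * (real j * d))) * emeasure M (?V j))"
    unfolding grid_discount_def by (subst nn_integral_suminf) (auto simp: nn_integral_cmult)
  also have "\<dots> = (\<Sum>j. c * (ennreal (exp (- lam * (real j * d))) * emeasure M (?V j)))"
    by simp
  also have "\<dots> \<le> (\<Sum>j. \<integral>\<^sup>+\<omega>. indicator (?V j) \<omega> * W \<omega> \<partial>M)"
    by (intro suminf_le step) auto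
  also have "\<dots> = (\<integral>\<^sup>+\<omega>. (\<Sum>j. indicator (?V j) \<omega> * W \<omega>) \<partial>M)"
    by (rule nn_integral_suminf[symmetric]) measurable
  also have "\<dots> \<le> (\<integral>\<^sup>+\<omega>. W \<omega> \<partial>M)"
  proof (rule nn_integral_mono)
    fix \<omega>
    have "(\<Sum>j. indicator (?V j) \<omega> * W \<omega>) = indicator (\<Union>j. ?V j) \<omega> * W \<omega>"
      by (simp add: suminf_indicator[OF disjoint_first_visit])
    also have "\<dots> \<le> W \<omega>"
      by (simp add: indicator_def)
    finally show "(\<Sum>j. indicator (?V j) \<omega> * W \<omega>) \<le> W \<omega>" .
  qed
  also have "\<dots> = (\<integral>\<^sup>+z. f z \<partial>resolvent_measure lam)"
    unfolding nn_integral_resolvent_measure_swap[OF assms(2)] by (rule nn_integral_cong_AE) (rule W_AE)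
  finally show ?thesis .
qed

text \<open>Some grid time lies in \<open>[t, t + d]\<close>, and the path is in \<open>B\<close>
  then, so the first visit along the grid happens no later than \<open>t + d\<close>.\<close>

lemma exp_le_grid_discount:
  assumes \<omega>: "\<omega> \<in> space M" and d: "0 < d" and t: "0 \<le> t" and lam: "0 \<le> lam"
    and B: "\<And>s. t \<le> s \<Longrightarrow> s \<le> t + d \<Longrightarrow> X s \<omega> \<in> B"
  shows "ennreal (exp (- lam * (t + d))) \<le> grid_discount lam d B \<omega>"
proof -
  define j where "j = nat \<lceil>t / d\<rceil>"
  have "real j = real_of_int \<lceil>t / d\<rceil>"
    using t d by (simp add: j_def)
  then have "t / d \<le> real j" "real j \<le> t / d + 1"
    by linarith+
  then have j: "t \<le> real j * d" "real j * d \<le> t + d"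
    using d by (simp_all add: field_simps)
  define i where "i = (LEAST i. X (real i * d) \<omega> \<in> B)"
  have Bj: "X (real j * d) \<omega> \<in> B"
    using B j by blast
  have "i \<le> j" "X (real i * d) \<omega> \<in> B"
    unfolding i_def by (rule Least_le, rule Bj) (rule LeastI, rule Bj)
  moreover have "X (real l * d) \<omega> \<notin> B" if "l < i" for l
    using that not_less_Least unfolding i_def by blast
  ultimately have i: "i \<le> j" "\<omega> \<in> first_visit d B i"
    using \<omega> by (auto simp: first_visit_def)
  have "real i * d \<le> t + d"
    by (rule order_trans[OF mult_right_mono j(2)]) (use i(1) d in auto)
  then have "ennreal (exp (- lam * (t + d))) \<le> ennreal (exp (- lam * (real i * d))) * indicator (first_visit d B i) \<omega>"
    using i(2) lam by (auto intro!: ennreal_leI mult_left_mono)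
  also have "\<dots> \<le> grid_discount lam d B \<omega>"
  proof -
    define F where "F j = ennreal (exp (- lam * (real j * d))) * indicator (first_visit d B j) \<omega>" for j
    have "F i \<le> (\<Sum>j. F j)"
      using sum_le_suminf[OF summableI, of "{i}" F] by simp
    then show ?thesis
      unfolding F_def grid_discount_def .
  qed
  finally show ?thesis .
qed

text \<open>After a hit, right-continuity keeps the path in the open set \<open>B\<close> for a
  while, and every grid finer than that stretch has a visit within one mesh width of the
  hit.\<close>

lemma exp_discount_le_liminf:
  assumes \<omega>: "\<omega> \<in> space M" and cad: "cadlag (\<lambda>t. X t \<omega>)" and lam: "0 < lam"
    and B: "open B" "y \<in> B"
  shows "ennreal (exp_discount lam (hitting_time X y \<omega>))
    \<le> liminf (\<lambda>k. grid_discount lam (1 / real (Suc k)) B \<omega>)" (is "_ \<le> ?L")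
\<comment> \<open>Without a hit the hitting time is infinite and its discount is 0.\<close>
proof (cases "{t. 0 < t \<and> X t \<omega> = y} = {}")
  case True
  then show ?thesis
    unfolding hitting_time_def True by (simp add: exp_discount_def top_ereal_def)
next
  case False
  define T where "T = hitting_time X y \<omega>"
  have d_lim: "(\<lambda>k. 1 / real (Suc k)) \<longlonglongrightarrow> 0"
    using LIMSEQ_inverse_real_of_nat by (simp add: inverse_eq_divide)
  have hit: "ennreal (exp (- lam * t)) \<le> ?L" if t: "0 < t" "X t \<omega> = y" for t
  proof -
    have "((\<lambda>s. X s \<omega>) \<longlongrightarrow> y) (at_right t)"
      using cad t unfolding cadlag_def by auto
    then have "eventually (\<lambda>s. X s \<omega> \<in> B) (at_right t)"
      using B by (rule topological_tendstoD)
    then obtain b where b: "t < b" "\<And>s. t < s \<Longrightarrow> s < b \<Longrightarrow> X s \<omega> \<in> B"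
      by (auto simp: eventually_at_right_field)
    have "\<forall>\<^sub>F k in sequentially. 1 / real (Suc k) < b - t"
      using d_lim b(1) by (auto intro: order_tendstoD)
    then have *: "\<forall>\<^sub>F k in sequentially. ennreal (exp (- lam * (t + 1 / real (Suc k))))
      \<le> grid_discount lam (1 / real (Suc k)) B \<omega>"
    proof eventually_elim
      case (elim k)
      show ?case
      proof (rule exp_le_grid_discount)
        fix s assume "t \<le> s" "s \<le> t + 1 / real (Suc k)"
        with elim b(2)[of s] show "X s \<omega> \<in> B"
          using t B by (cases "s = t") auto
      qed (use \<omega> t lam in auto)
    qed
    have "(\<lambda>k. ennreal (exp (- lam * (t + 1 / real (Suc k))))) \<longlonglongrightarrow> ennreal (exp (- lam * (t + 0)))"
      by (intro tendsto_ennrealI tendsto_intros d_lim)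
    from lim_imp_Liminf[OF sequentially_bot this]
    have "ennreal (exp (- lam * t)) = liminf (\<lambda>k. ennreal (exp (- lam * (t + 1 / real (Suc k)))))"
      unfolding add_0_right by (rule sym)
    also have "\<dots> \<le> ?L"
      by (rule Liminf_mono[OF *])
    finally show ?thesis .
  qed
  obtain t0 where t0: "0 < t0" "X t0 \<omega> = y"
    using False by auto
  have "T \<le> ereal t0"
    unfolding T_def hitting_time_def by (rule Inf_lower) (use t0 in auto)
  moreover have "0 \<le> T"
    unfolding T_def hitting_time_def by (rule Inf_greatest) auto
  ultimately obtain \<tau> where \<tau>: "T = ereal \<tau>" "0 \<le> \<tau>"
    by (cases T) auto
  \<comment> \<open>The infimum need not be attained, for instance when it is 0. It is approached
    through hits before \<open>\<tau> + e\<close>, and \<open>e\<close> tends to 0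
    afterwards.\<close>
  have "ennreal (exp (- lam * (\<tau> + e))) \<le> ?L" if "0 < e" for e
  proof -
    have "T < ereal (\<tau> + e)" using \<tau> that by simp
    then obtain t where t: "0 < t" "X t \<omega> = y" "t < \<tau> + e"
      unfolding T_def hitting_time_def Inf_less_iff by auto
    then have "ennreal (exp (- lam * (\<tau> + e))) \<le> ennreal (exp (- lam * t))"
      using lam by (intro ennreal_leI) auto
    also have "\<dots> \<le> ?L" using t by (intro hit)
    finally show ?thesis .
  qed
  then have "\<forall>\<^sub>F e in at_right 0. ennreal (exp (- lam * (\<tau> + e))) \<le> ?L"
    by (simp add: eventually_at_filter)
  moreover have "((\<lambda>e. ennreal (exp (- lam * (\<tau> + e)))) \<longlongrightarrow> ennreal (exp (- lam * (\<tau> + 0)))) (at_right 0)"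
    by (intro tendsto_ennrealI tendsto_intros)
  ultimately have "ennreal (exp (- lam * (\<tau> + 0))) \<le> ?L"
    by (intro tendsto_upperbound) auto
  then show ?thesis
    using \<tau> by (simp add: T_def exp_discount_def)
qed

text \<open>Nonnegative integrals over \<open>M\<close> and over its completion agree, so the
  pathwise estimate can be integrated. If the discount is not integrable, the left side is 0 by
  convention.\<close>

lemma hitting_laplace_le_liminf:
  assumes lam: "0 < lam" and B: "open B" "y \<in> B"
  shows "ennreal (hitting_laplace M X lam y)
    \<le> (\<integral>\<^sup>+\<omega>. liminf (\<lambda>k. grid_discount lam (1 / real (Suc k)) B \<omega>) \<partial>M)"
proof (cases "integrable (completion M) (\<lambda>\<omega>. exp_discount lam (hitting_time X y \<omega>))")
  case True
  then have "ennreal (hitting_laplace M X lam y)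
      = (\<integral>\<^sup>+\<omega>. ennreal (exp_discount lam (hitting_time X y \<omega>)) \<partial>completion M)"
    unfolding hitting_laplace_def by (intro nn_integral_eq_integral[symmetric]) (auto simp: exp_discount_def)
  also have "\<dots> = (\<integral>\<^sup>+\<omega>. ennreal (exp_discount lam (hitting_time X y \<omega>)) \<partial>M)"
    by (rule nn_integral_completion)
  also have "\<dots> \<le> (\<integral>\<^sup>+\<omega>. liminf (\<lambda>k. grid_discount lam (1 / real (Suc k)) B \<omega>) \<partial>M)"
    by (rule nn_integral_mono_AE, use AE_not_bad in eventually_elim)
       (intro exp_discount_le_liminf bad_paths(3) lam B, auto)
  finally show ?thesis .
qed (simp add: hitting_laplace_def not_integrable_integral_eq)

lemma measurable_grid_discount [measurable]:
  assumes "0 < d" and [measurable]: "B \<in> sets borel"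
  shows "grid_discount lam d B \<in> borel_measurable M"
proof -
  have [measurable]: "first_visit d B j \<in> sets M" for j
    using assms by measurable
  show ?thesis unfolding grid_discount_def by measurable
qed

text \<open>Fatou's lemma, carried out through the infima \<open>H m\<close>: they increase to the
  limit inferior, and each lies below \<open>?G m\<close>, where the bound for a single grid
  applies.\<close>

lemma resolvent_ge_liminf_grid_discount:
  assumes [measurable]: "B \<in> sets borel" "f \<in> borel_measurable borel"
    and c: "\<And>x. x \<in> B \<Longrightarrow> c \<le> (\<integral>\<^sup>+z. f (x + z) \<partial>resolvent_measure lam)"
  shows "c * (\<integral>\<^sup>+\<omega>. liminf (\<lambda>k. grid_discount lam (1 / real (Suc k)) B \<omega>) \<partial>M)
    \<le> (\<integral>\<^sup>+z. f z \<partial>resolvent_measure lam)"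
proof -
  let ?G = "\<lambda>k. grid_discount lam (1 / real (Suc k)) B"
  define H where "H m \<omega> = (INF k\<in>{m..}. ?G k \<omega>)" for m \<omega>
  have [measurable]: "?G k \<in> borel_measurable M" for k
    by measurable
  have [measurable]: "H m \<in> borel_measurable M" for m
    unfolding H_def by measurable
  have "incseq H"
    unfolding H_def by (intro incseq_SucI le_funI INF_superset_mono) auto
  then have "(\<integral>\<^sup>+\<omega>. (SUP m. H m \<omega>) \<partial>M) = (SUP m. \<integral>\<^sup>+\<omega>. H m \<omega> \<partial>M)"
    by (rule nn_integral_monotone_convergence_SUP) simp
  then have "c * (\<integral>\<^sup>+\<omega>. liminf (\<lambda>k. ?G k \<omega>) \<partial>M) = (SUP m. c * (\<integral>\<^sup>+\<omega>. H m \<omega> \<partial>M))"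
    by (simp add: liminf_SUP_INF H_def SUP_mult_left_ennreal)
  also have "\<dots> \<le> (\<integral>\<^sup>+z. f z \<partial>resolvent_measure lam)"
  proof (rule SUP_least)
    fix m
    have "c * (\<integral>\<^sup>+\<omega>. H m \<omega> \<partial>M) \<le> c * (\<integral>\<^sup>+\<omega>. ?G m \<omega> \<partial>M)"
      by (intro mult_left_mono nn_integral_mono) (auto simp: H_def intro: INF_lower)
    also have "\<dots> \<le> (\<integral>\<^sup>+z. f z \<partial>resolvent_measure lam)"
      by (rule resolvent_ge_grid_discount) (auto intro: c)
    finally show "c * (\<integral>\<^sup>+\<omega>. H m \<omega> \<partial>M) \<le> (\<integral>\<^sup>+z. f z \<partial>resolvent_measure lam)" .
  qed
  finally show ?thesis .
qed

text \<open>A point of \<open>E n\<close> stays in \<open>A\<close> under shifts smaller than \<open>1 / Suc n\<close>, which absorbs the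
  error made by visiting a ball around \<open>y\<close> rather than \<open>y\<close>.\<close>

lemma resolvent_ge_hitting_open:
  assumes lam: "0 < lam" and A: "open A"
  shows "ennreal (hitting_laplace M X lam y) * emeasure (resolvent_measure lam) {z. y + z \<in> A}
    \<le> emeasure (resolvent_measure lam) A"
proof -
  define E where "E n = {w. ball w (1 / real (Suc n)) \<subseteq> A}" for n
  have E_closed: "closed (E n)" for n
  proof -
    have "- E n = (\<Union>a\<in>-A. ball a (1 / real (Suc n)))"
      by (auto simp: E_def subset_eq dist_commute)
    then have "open (- E n)" by auto
    then show ?thesis by (simp add: closed_def)
  qed
  have [measurable]: "E n \<in> sets borel" "A \<in> sets borel" for n
    using E_closed A by (auto intro: borel_closed)
  have meas: "{z. y + z \<in> S} \<in> sets (resolvent_measure lam)" if [measurable]: "S \<in> sets borel" for S y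
  proof -
    have "{z \<in> space borel. y + z \<in> S} \<in> sets borel" by measurable
    then show ?thesis by simp
  qed
  have E_mono: "incseq (\<lambda>n. {z. y + z \<in> E n})"
  proof (rule incseq_SucI)
    fix n
    have "1 / real (Suc (Suc n)) \<le> 1 / real (Suc n)"
      by (simp add: frac_le)
    then have "E n \<subseteq> E (Suc n)"
      unfolding E_def using subset_ball by blast
    then show "{z. y + z \<in> E n} \<subseteq> {z. y + z \<in> E (Suc n)}" by auto
  qed
  have E_Un: "(\<Union>n. {z. y + z \<in> E n}) = {z. y + z \<in> A}"
  proof (intro set_eqI iffI)
    fix z assume "z \<in> {z. y + z \<in> A}"
    then obtain e where e: "0 < e" "ball (y + z) e \<subseteq> A"
      using A by (auto simp: open_contains_ball)
    obtain n where "1 / real (Suc n) < e"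
      using e(1) nat_approx_posE by blast
    then have "ball (y + z) (1 / real (Suc n)) \<subseteq> A"
      using e(2) subset_ball[of "1 / real (Suc n)" e "y + z"] by auto
    then show "z \<in> (\<Union>n. {z. y + z \<in> E n})"
      by (auto simp: E_def)
  next
    fix z assume "z \<in> (\<Union>n. {z. y + z \<in> E n})"
    then obtain n where "ball (y + z) (1 / real (Suc n)) \<subseteq> A"
      by (auto simp: E_def)
    moreover have "y + z \<in> ball (y + z) (1 / real (Suc n))"
      by simp
    ultimately show "z \<in> {z. y + z \<in> A}" by blast
  qed
  \<comment> \<open>As \<open>A\<close> is open, the sets \<open>E n\<close> exhaust it, and
    continuity from below reduces the claim to a fixed \<open>n\<close>.\<close>
  have "ennreal (hitting_laplace M X lam y) * emeasure (resolvent_measure lam) {z. y + z \<in> A}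
      = (SUP n. ennreal (hitting_laplace M X lam y) * emeasure (resolvent_measure lam) {z. y + z \<in> E n})"
    unfolding E_Un[symmetric] SUP_mult_left_ennreal[symmetric]
    by (subst SUP_emeasure_incseq) (use E_mono meas in auto)
  also have "\<dots> \<le> emeasure (resolvent_measure lam) A"
  proof (rule SUP_least)
    fix n
    let ?B = "ball y (1 / real (Suc n))"
    let ?c = "emeasure (resolvent_measure lam) {z. y + z \<in> E n}"
    have c: "?c \<le> (\<integral>\<^sup>+z. indicator A (x + z) \<partial>resolvent_measure lam)" if x: "x \<in> ?B" for x
    proof -
      have "{z. y + z \<in> E n} \<subseteq> {z. x + z \<in> A}"
      proof safe
        fix z assume "y + z \<in> E n"
        then have "ball (y + z) (1 / real (Suc n)) \<subseteq> A" by (simp add: E_def)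
        moreover have "x + z \<in> ball (y + z) (1 / real (Suc n))"
          using x by (simp add: dist_real_def)
        ultimately show "x + z \<in> A" by blast
      qed
      then have "?c \<le> emeasure (resolvent_measure lam) {z. x + z \<in> A}"
        by (rule emeasure_mono) (simp add: meas)
      also have "\<dots> = (\<integral>\<^sup>+z. indicator {z. x + z \<in> A} z \<partial>resolvent_measure lam)"
        by (subst nn_integral_indicator) (simp_all add: meas)
      finally show ?thesis
        by (simp add: indicator_def)
    qed
    have "ennreal (hitting_laplace M X lam y) * ?c
      \<le> (\<integral>\<^sup>+\<omega>. liminf (\<lambda>k. grid_discount lam (1 / real (Suc k)) ?B \<omega>) \<partial>M) * ?c"
      by (intro mult_right_mono hitting_laplace_le_liminf lam) auto
    also have "\<dots> \<le> (\<integral>\<^sup>+z. indicator A z \<partial>resolvent_measure lam)"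
      by (subst mult.commute, rule resolvent_ge_liminf_grid_discount) (auto intro: c)
    also have "\<dots> = emeasure (resolvent_measure lam) A" by simp
    finally show "ennreal (hitting_laplace M X lam y) * ?c \<le> emeasure (resolvent_measure lam) A" .
  qed
  finally show ?thesis .
qed

text \<open>The resolvent measure is finite, hence outer regular, which extends the inequality from
  open to Borel sets. A scaled translate of the measure thus lies below the measure, and integrals
  inherit this order.\<close>

lemma resolvent_ge_hitting:
  assumes lam: "0 < lam" and f[measurable]: "f \<in> borel_measurable borel"
  shows "ennreal (hitting_laplace M X lam y) * (\<integral>\<^sup>+z. f (y + z) \<partial>resolvent_measure lam)
    \<le> (\<integral>\<^sup>+z. f z \<partial>resolvent_measure lam)"
proof -
  let ?R = "resolvent_measure lam"
  let ?h = "ennreal (hitting_laplace M X lam y)"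
  let ?S = "scale_measure ?h (distr ?R borel (\<lambda>z. y + z))"
  have emeasure_S: "emeasure ?S B = ?h * emeasure ?R {z. y + z \<in> B}" if "B \<in> sets borel" for B
    using that by (simp add: emeasure_distr vimage_def)
  have "?S \<le> ?R"
  proof -
    have "emeasure ?S B \<le> emeasure ?R B" for B
    proof (cases "B \<in> sets borel")
      case B: True
      have "emeasure ?R B = (INF U\<in>{U. B \<subseteq> U \<and> open U}. emeasure ?R U)"
        by (rule outer_regular) (simp_all add: emeasure_resolvent_measure_UNIV lam B)
      also have "emeasure ?S B \<le> \<dots>"
      proof (rule INF_greatest)
        fix U assume U: "U \<in> {U. B \<subseteq> U \<and> open U}"
        then have "emeasure ?S B \<le> emeasure ?S U"
          by (intro emeasure_mono) auto
        also have "\<dots> = ?h * emeasure ?R {z. y + z \<in> U}"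
          using U by (intro emeasure_S) auto
        also have "\<dots> \<le> emeasure ?R U"
          using U lam by (intro resolvent_ge_hitting_open) auto
        finally show "emeasure ?S B \<le> emeasure ?R U" .
      qed
      finally show ?thesis .
    qed (simp add: emeasure_notin_sets)
    then show ?thesis
      by (simp add: le_measure_iff le_fun_def)
  qed
  then have "nn_integral ?S f \<le> nn_integral ?R f"
    by (intro nn_integral_mono_measure) simp_all
  moreover have "nn_integral ?S f = ?h * (\<integral>\<^sup>+z. f (y + z) \<partial>?R)"
    by (simp add: nn_integral_scale_measure nn_integral_distr)
  ultimately show ?thesis by simp
qed

text \<open>Bernoulli's inequality, applied to \<open>e\<^bsup>-m\<lambda>T\<^esup> = (1 + (e\<^bsup>-\<lambda>T\<^esup> - 1))\<^sup>m\<close>.\<close>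

lemma hitting_laplace_mult_tendsto_1:
  assumes lim: "(hitting_laplace M X lam \<longlongrightarrow> 1) (at 0)" and lam: "0 < lam" and m: "0 < m"
  shows "(hitting_laplace M X (real m * lam) \<longlongrightarrow> 1) (at 0)"
proof (rule tendsto_sandwich)
  interpret C: prob_space "completion M"
    by (rule prob_space_completion)
  let ?D = "\<lambda>lam y \<omega>. exp_discount lam (hitting_time X y \<omega>)"
  \<comment> \<open>A non-integrable discount would give \<open>hitting_laplace\<close> the default
    value 0, so the threshold \<open>1 / 2\<close> forces integrability.\<close>
  have "\<forall>\<^sub>F y in at 0. 1 / 2 < hitting_laplace M X lam y"
    using lim by (rule order_tendstoD) simp
  then have "\<forall>\<^sub>F y in at 0. 1 + real m * (hitting_laplace M X lam y - 1) \<le> hitting_laplace M X (real m * lam) y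
      \<and> hitting_laplace M X (real m * lam) y \<le> 1"
  proof eventually_elim
    case (elim y)
    have int: "integrable (completion M) (?D lam y)"
    proof (rule ccontr)
      assume "\<not> ?thesis"
      then have "hitting_laplace M X lam y = 0"
        unfolding hitting_laplace_def by (rule not_integrable_integral_eq)
      with elim show False by simp
    qed
    have bounds: "0 \<le> ?D lam y \<omega>" "?D lam y \<omega> \<le> 1" for \<omega>
      using exp_discount_bounds[OF hitting_time_nonneg[of X y \<omega>]] lam by auto
    have [measurable]: "?D lam y \<in> borel_measurable (completion M)"
      using int by (rule borel_measurable_integrable)
    have int': "integrable (completion M) (\<lambda>\<omega>. ?D lam y \<omega> ^ m)"
      by (rule C.integrable_const_bound[where B = 1]) (auto simp: bounds intro!: power_le_one)
    have "1 + real m * (hitting_laplace M X lam y - 1)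
        = (LINT \<omega>|completion M. 1 + real m * (?D lam y \<omega> - 1))"
      using int by (simp add: hitting_laplace_def prob_space)
    also have "\<dots> \<le> (LINT \<omega>|completion M. ?D lam y \<omega> ^ m)"
    proof (rule integral_mono)
      fix \<omega>
      show "1 + real m * (?D lam y \<omega> - 1) \<le> ?D lam y \<omega> ^ m"
        using Bernoulli_inequality[of "?D lam y \<omega> - 1" m] bounds(1)[of \<omega>] by simp
    qed (use int int' in auto)
    finally have lower: "1 + real m * (hitting_laplace M X lam y - 1) \<le> (LINT \<omega>|completion M. ?D lam y \<omega> ^ m)" .
    have "(LINT \<omega>|completion M. ?D lam y \<omega> ^ m) \<le> (LINT \<omega>|completion M. 1)"
      using int' by (intro integral_mono) (auto simp: bounds intro!: power_le_one)
    with lower show ?case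
      by (simp add: hitting_laplace_def exp_discount_power[OF m] prob_space)
  qed
  then show "\<forall>\<^sub>F y in at 0. 1 + real m * (hitting_laplace M X lam y - 1) \<le> hitting_laplace M X (real m * lam) y"
    "\<forall>\<^sub>F y in at 0. hitting_laplace M X (real m * lam) y \<le> 1"
    by (auto elim: eventually_mono)
  have "((\<lambda>y. 1 + real m * (hitting_laplace M X lam y - 1)) \<longlongrightarrow> 1 + real m * (1 - 1)) (at 0)"
    by (intro tendsto_intros lim)
  then show "((\<lambda>y. 1 + real m * (hitting_laplace M X lam y - 1)) \<longlongrightarrow> 1) (at 0)"
    by simp
qed simp

section \<open>Potentials of nonnegative functions and their Harnack inequality\<close>

definition potential :: "real \<Rightarrow> (real \<Rightarrow> ennreal) \<Rightarrow> real \<Rightarrow> ennreal" where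
  "potential lam f x = (\<integral>\<^sup>+z. f (x + z) \<partial>resolvent_measure lam)"

text \<open>The limit provides a ball on which the hitting factor exceeds \<open>e\<close>, and the
  hitting inequality is applied to the translate of \<open>f\<close> by \<open>x\<close>; hence one
  radius serves all \<open>f\<close> and \<open>x\<close>. The punctured limit says nothing about
  \<open>y = 0\<close>, where the claim is trivial.\<close>

lemma potential_harnack:
  assumes lim: "(hitting_laplace M X lam \<longlongrightarrow> 1) (at 0)" and lam: "0 < lam" and e: "e < 1"
  obtains \<delta> where "0 < \<delta>"
    "\<And>f x y. f \<in> borel_measurable borel \<Longrightarrow> \<bar>y\<bar> < \<delta> \<Longrightarrow> ennreal e * potential lam f (x + y) \<le> potential lam f x"
proof -
  have "\<forall>\<^sub>F y in at 0. e < hitting_laplace M X lam y"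
    using lim e by (rule order_tendstoD)
  then obtain \<delta> where \<delta>: "0 < \<delta>" "\<And>y. y \<noteq> 0 \<Longrightarrow> \<bar>y\<bar> < \<delta> \<Longrightarrow> e < hitting_laplace M X lam y"
    by (auto simp: eventually_at dist_real_def)
  show ?thesis
  proof (rule that[OF \<delta>(1)])
    fix f :: "real \<Rightarrow> ennreal" and x y :: real
    assume [measurable]: "f \<in> borel_measurable borel" and y: "\<bar>y\<bar> < \<delta>"
    show "ennreal e * potential lam f (x + y) \<le> potential lam f x"
    proof (cases "y = 0")
      case True
      have "ennreal e * potential lam f x \<le> 1 * potential lam f x"
        using e by (intro mult_right_mono) (auto intro: ennreal_leI[of e 1, simplified])
      with True show ?thesis by simp
    next
      case False
      have "ennreal e * potential lam f (x + y) \<le> ennreal (hitting_laplace M X lam y) * potential lam f (x + y)"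
        using \<delta>(2)[OF False y] by (intro mult_right_mono ennreal_leI) auto
      also have "\<dots> \<le> potential lam f x"
        using resolvent_ge_hitting[OF lam, of "\<lambda>z. f (x + z)" y] by (simp add: potential_def add.assoc)
      finally show ?thesis .
    qed
  qed
qed

section \<open>Comparison of the potential with integrals over balls\<close>

lemma finite_measure_resolvent_measure: "0 < lam \<Longrightarrow> finite_measure (resolvent_measure lam)"
  by (rule finite_measureI) (simp add: emeasure_resolvent_measure_UNIV)

lemma measurable_potential [measurable]:
  assumes "0 < lam" and [measurable]: "f \<in> borel_measurable borel"
  shows "potential lam f \<in> borel_measurable borel"
proof -
  interpret finite_measure "resolvent_measure lam"
    using assms(1) by (rule finite_measure_resolvent_measure)
  show ?thesis unfolding potential_def by measurable
qed

text \<open>Fubini's theorem moves the integration over starting points onto \<open>f\<close>, so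
  that the potential is compared with ball integrals of \<open>f\<close> under Lebesgue
  measure.\<close>

lemma nn_integral_potential_ball:
  assumes lam: "0 < lam" and [measurable]: "f \<in> borel_measurable borel"
  shows "(\<integral>\<^sup>+y\<in>ball 0 \<delta>. potential lam f (x + y) \<partial>lborel)
    = (\<integral>\<^sup>+z. (\<integral>\<^sup>+w\<in>ball (x + z) \<delta>. f w \<partial>lborel) \<partial>resolvent_measure lam)"
proof -
  interpret R: finite_measure "resolvent_measure lam"
    using lam by (rule finite_measure_resolvent_measure)
  interpret pair_sigma_finite lborel "resolvent_measure lam" ..
  have "(\<integral>\<^sup>+y\<in>ball 0 \<delta>. potential lam f (x + y) \<partial>lborel)
      = (\<integral>\<^sup>+y. \<integral>\<^sup>+z. f (x + y + z) * indicator (ball 0 \<delta>) y \<partial>resolvent_measure lam \<partial>lborel)"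
    unfolding potential_def by (intro nn_integral_cong nn_integral_multc[symmetric]) measurable
  also have "\<dots> = (\<integral>\<^sup>+z. \<integral>\<^sup>+y. f (x + y + z) * indicator (ball 0 \<delta>) y \<partial>lborel \<partial>resolvent_measure lam)"
    by (rule Fubini'[symmetric]) measurable
  also have "\<dots> = (\<integral>\<^sup>+z. (\<integral>\<^sup>+w\<in>ball (x + z) \<delta>. f w \<partial>lborel) \<partial>resolvent_measure lam)"
  proof (rule nn_integral_cong)
    fix z
    have "(\<integral>\<^sup>+w\<in>ball (x + z) \<delta>. f w \<partial>lborel)
        = (\<integral>\<^sup>+y. f ((x + z) + y) * indicator (ball (x + z) \<delta>) ((x + z) + y) \<partial>lborel)"
      by (rule nn_integral_lborel_translate) measurable
    also have "\<dots> = (\<integral>\<^sup>+y. f (x + y + z) * indicator (ball 0 \<delta>) y \<partial>lborel)"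
      by (intro nn_integral_cong arg_cong2[where f = times]) (auto simp: indicator_def dist_real_def ac_simps)
    finally show "(\<integral>\<^sup>+y. f (x + y + z) * indicator (ball 0 \<delta>) y \<partial>lborel) = (\<integral>\<^sup>+w\<in>ball (x + z) \<delta>. f w \<partial>lborel)" ..
  qed
  finally show ?thesis .
qed

lemma potential_doubling:
  assumes lim: "(hitting_laplace M X lam \<longlongrightarrow> 1) (at 0)" and lam: "0 < lam"
  obtains \<delta> where "0 < \<delta>"
    "\<And>f x y. f \<in> borel_measurable borel \<Longrightarrow> \<bar>y\<bar> < \<delta> \<Longrightarrow> potential lam f (x + y) \<le> 2 * potential lam f x"
proof -
  obtain \<delta> where "0 < \<delta>"
    "\<And>f x y. f \<in> borel_measurable borel \<Longrightarrow> \<bar>y\<bar> < \<delta> \<Longrightarrow> ennreal (1 / 2) * potential lam f (x + y) \<le> potential lam f x"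
    using potential_harnack[OF lim lam, of "1 / 2"] by auto
  then show ?thesis
    using that unfolding ennreal_half_mult_le_iff by blast
qed

text \<open>By doubling, \<open>2 * \<delta>\<close> times the potential at \<open>x\<close> is at
  most twice its integral over the ball around \<open>x\<close>. After Fubini this is twice an
  integral of ball integrals, each at most \<open>Q\<close>, over a measure of mass
  \<open>1 / lam\<close>.\<close>

lemma potential_upper:
  assumes lam: "0 < lam" and f[measurable]: "f \<in> borel_measurable borel" and \<delta>: "0 < \<delta>"
    and doubling: "\<And>x y. \<bar>y\<bar> < \<delta> \<Longrightarrow> potential lam f (x + y) \<le> 2 * potential lam f x"
    and Q: "\<And>x. (\<integral>\<^sup>+w\<in>ball x \<delta>. f w \<partial>lborel) \<le> Q"
  shows "potential lam f x \<le> ennreal (1 / (\<delta> * lam)) * Q"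
proof -
  note measurable_potential[OF lam, measurable]
  have "potential lam f x * ennreal (2 * \<delta>) = (\<integral>\<^sup>+y\<in>ball (0 :: real) \<delta>. potential lam f x \<partial>lborel)"
    using \<delta> by (simp add: nn_integral_cmult_indicator emeasure_lborel_ball_real)
  also have "\<dots> \<le> (\<integral>\<^sup>+y. 2 * (potential lam f (x + y) * indicator (ball 0 \<delta>) y) \<partial>lborel)"
  proof (rule nn_integral_mono)
    fix y :: real
    show "potential lam f x * indicator (ball 0 \<delta>) y \<le> 2 * (potential lam f (x + y) * indicator (ball 0 \<delta>) y)"
      using doubling[of "- y" "x + y"] by (auto simp: indicator_def)
  qed
  also have "\<dots> = 2 * (\<integral>\<^sup>+z. (\<integral>\<^sup>+w\<in>ball (x + z) \<delta>. f w \<partial>lborel) \<partial>resolvent_measure lam)"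
    by (subst nn_integral_cmult) (simp_all add: nn_integral_potential_ball[OF lam f])
  also have "\<dots> \<le> 2 * (\<integral>\<^sup>+z. Q \<partial>resolvent_measure lam)"
    by (intro mult_left_mono nn_integral_mono Q) simp
  also have "\<dots> = 2 * (Q * ennreal (1 / lam))"
    by (simp add: emeasure_resolvent_measure_UNIV lam)
  finally have "ennreal (1 / (2 * \<delta>)) * (potential lam f x * ennreal (2 * \<delta>))
      \<le> ennreal (1 / (2 * \<delta>)) * (2 * (Q * ennreal (1 / lam)))"
    by (intro mult_left_mono) auto
  also have "ennreal (1 / (2 * \<delta>)) * (potential lam f x * ennreal (2 * \<delta>))
      = (ennreal (1 / (2 * \<delta>)) * ennreal (2 * \<delta>)) * potential lam f x"
    by (simp only: ac_simps)
  also have "ennreal (1 / (2 * \<delta>)) * ennreal (2 * \<delta>) = 1"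
    using \<delta> by (simp add: ennreal_mult[symmetric])
  also have "ennreal (1 / (2 * \<delta>)) * (2 * (Q * ennreal (1 / lam)))
      = (ennreal (1 / (2 * \<delta>)) * ennreal 2 * ennreal (1 / lam)) * Q"
    by (simp add: ac_simps)
  also have "ennreal (1 / (2 * \<delta>)) * ennreal 2 * ennreal (1 / lam) = ennreal (1 / (\<delta> * lam))"
    using \<delta> lam by (subst ennreal_mult[symmetric], simp, simp, subst ennreal_mult[symmetric]) simp_all
  finally show ?thesis by simp
qed

text \<open>For \<open>z\<close> in \<open>ball 0 (\<delta> / 2)\<close> the ball of radius
  \<open>\<delta>\<close> around \<open>x + z\<close> contains \<open>ball x (\<delta> / 2)\<close>.
  Keeping only these \<open>z\<close> bounds the integrated potential from below; doubling bounds it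
  from above by \<open>2 * \<delta>\<close> times twice the potential at \<open>x\<close>.\<close>

lemma potential_lower:
  assumes lam: "0 < lam" and f[measurable]: "f \<in> borel_measurable borel" and \<delta>: "0 < \<delta>"
    and doubling: "\<And>x y. \<bar>y\<bar> < \<delta> \<Longrightarrow> potential lam f (x + y) \<le> 2 * potential lam f x"
  shows "emeasure (resolvent_measure lam) (ball 0 (\<delta> / 2)) * (\<integral>\<^sup>+w\<in>ball x (\<delta> / 2). f w \<partial>lborel)
    \<le> ennreal (4 * \<delta>) * potential lam f x"
proof -
  note measurable_potential[OF lam, measurable]
  let ?I = "\<integral>\<^sup>+w\<in>ball x (\<delta> / 2). f w \<partial>lborel"
  have "emeasure (resolvent_measure lam) (ball 0 (\<delta> / 2)) * ?I
      = (\<integral>\<^sup>+z. ?I * indicator (ball 0 (\<delta> / 2)) z \<partial>resolvent_measure lam)"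
    by (subst nn_integral_cmult_indicator) (simp_all add: mult.commute)
  also have "\<dots> \<le> (\<integral>\<^sup>+z. (\<integral>\<^sup>+w\<in>ball (x + z) \<delta>. f w \<partial>lborel) \<partial>resolvent_measure lam)"
  proof (rule nn_integral_mono)
    fix z :: real
    have "?I \<le> (\<integral>\<^sup>+w\<in>ball (x + z) \<delta>. f w \<partial>lborel)" if z: "z \<in> ball 0 (\<delta> / 2)"
    proof -
      have "w \<in> ball (x + z) \<delta>" if "w \<in> ball x (\<delta> / 2)" for w
        using z that unfolding mem_ball dist_real_def by linarith
      then show ?thesis
        by (intro nn_integral_mono mult_left_mono) (auto simp: indicator_def simp del: mem_ball)
    qed
    then show "?I * indicator (ball 0 (\<delta> / 2)) z \<le> (\<integral>\<^sup>+w\<in>ball (x + z) \<delta>. f w \<partial>lborel)"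
      by (simp add: indicator_def)
  qed
  also have "\<dots> = (\<integral>\<^sup>+y\<in>ball 0 \<delta>. potential lam f (x + y) \<partial>lborel)"
    by (rule nn_integral_potential_ball[OF lam f, symmetric])
  also have "\<dots> \<le> (\<integral>\<^sup>+y\<in>ball (0 :: real) \<delta>. 2 * potential lam f x \<partial>lborel)"
    by (intro nn_integral_mono) (simp add: indicator_def dist_real_def doubling)
  also have "\<dots> = 2 * potential lam f x * ennreal (2 * \<delta>)"
    using \<delta> by (simp add: nn_integral_cmult_indicator emeasure_lborel_ball_real)
  also have "\<dots> = (ennreal 2 * ennreal (2 * \<delta>)) * potential lam f x"
    by (simp add: ac_simps)
  also have "ennreal 2 * ennreal (2 * \<delta>) = ennreal (4 * \<delta>)"
    using \<delta> by (subst ennreal_mult[symmetric]) simp_all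
  finally show ?thesis .
qed

section \<open>Behaviour of the process at small times\<close>

lemma prob_near_start_tendsto:
  assumes r: "0 < r"
  shows "((\<lambda>t. prob {\<omega> \<in> space M. X t \<omega> \<in> ball 0 r}) \<longlongrightarrow> 1) (at_right 0)"
proof (rule tendsto_sandwich)
  \<comment> \<open>The radius is halved because failing the strict inequality only gives
    \<open>\<le>\<close>, while the target ball is open.\<close>
  have "((\<lambda>s. prob {\<omega> \<in> space M. \<bar>X s \<omega> - X 0 \<omega>\<bar> > r / 2}) \<longlongrightarrow> 0) (at 0 within {0..})"
    by (rule stochastically_continuous) (use r in auto)
  then have "((\<lambda>s. prob {\<omega> \<in> space M. \<bar>X s \<omega> - X 0 \<omega>\<bar> > r / 2}) \<longlongrightarrow> 0) (at_right 0)"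
    by (rule tendsto_within_subset) auto
  from tendsto_diff[OF tendsto_const this]
  show "((\<lambda>s. 1 - prob {\<omega> \<in> space M. \<bar>X s \<omega> - X 0 \<omega>\<bar> > r / 2}) \<longlongrightarrow> 1) (at_right 0)"
    by simp
  have "1 - prob {\<omega> \<in> space M. \<bar>X s \<omega> - X 0 \<omega>\<bar> > r / 2} \<le> prob {\<omega> \<in> space M. X s \<omega> \<in> ball 0 r}" if "0 \<le> s" for s
  proof -
    have [measurable]: "random_variable borel (X s)" "random_variable borel (X 0)"
      using that by (auto intro!: random_variable_levy)
    have "1 - prob {\<omega> \<in> space M. \<bar>X s \<omega> - X 0 \<omega>\<bar> > r / 2} = prob {\<omega> \<in> space M. \<not> \<bar>X s \<omega> - X 0 \<omega>\<bar> > r / 2}"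
      by (rule prob_neg[symmetric]) measurable
    also have "\<dots> \<le> prob {\<omega> \<in> space M. X s \<omega> \<in> ball 0 r}"
    proof (rule finite_measure_mono_AE)
      show "AE \<omega> in M. \<omega> \<in> {\<omega> \<in> space M. \<not> \<bar>X s \<omega> - X 0 \<omega>\<bar> > r / 2}
          \<longrightarrow> \<omega> \<in> {\<omega> \<in> space M. X s \<omega> \<in> ball 0 r}"
        using starts_at_0 by eventually_elim (use r in \<open>auto simp: dist_real_def\<close>)
    qed measurable
    finally show ?thesis .
  qed
  then show "\<forall>\<^sub>F s in at_right 0. 1 - prob {\<omega> \<in> space M. \<bar>X s \<omega> - X 0 \<omega>\<bar> > r / 2}
      \<le> prob {\<omega> \<in> space M. X s \<omega> \<in> ball 0 r}"
    by (simp add: eventually_at_filter)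
  show "\<forall>\<^sub>F s in at_right 0. prob {\<omega> \<in> space M. X s \<omega> \<in> ball 0 r} \<le> 1"
    by simp
qed (rule tendsto_const)

text \<open>For all small times the process is in the ball with probability above
  \<open>1 / 2\<close>, so it spends a positive expected time there. This allows dividing by the
  constant in \<open>potential_lower\<close>.\<close>

lemma emeasure_resolvent_measure_ball_pos:
  assumes lam: "0 < lam" and r: "0 < r"
  shows "0 < emeasure (resolvent_measure lam) (ball 0 r)"
proof -
  have "\<forall>\<^sub>F t in at_right 0. 1 / 2 < prob {\<omega> \<in> space M. X t \<omega> \<in> ball 0 r}"
    using prob_near_start_tendsto[OF r] by (rule order_tendstoD) simp
  then obtain b where b: "0 < b" "\<And>t. 0 < t \<Longrightarrow> t < b \<Longrightarrow> 1 / 2 < prob {\<omega> \<in> space M. X t \<omega> \<in> ball 0 r}"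
    by (auto simp: eventually_at_right_field)
  have "0 < ennreal (exp (- lam * b) * (1 / 2)) * ennreal b"
    using b(1) by (simp add: ennreal_zero_less_mult_iff)
  also have "\<dots> = (\<integral>\<^sup>+u\<in>{0<..<b}. ennreal (exp (- lam * b) * (1 / 2)) \<partial>lborel)"
    using b(1) by (simp add: nn_integral_cmult_indicator)
  also have "\<dots> \<le> (\<integral>\<^sup>+u\<in>{0..}. ennreal (exp (- lam * u)) * (\<integral>\<^sup>+\<omega>. indicator (ball 0 r) (X u \<omega>) \<partial>M) \<partial>lborel)"
  proof (rule nn_integral_mono)
    fix u :: real
    show "ennreal (exp (- lam * b) * (1 / 2)) * indicator {0<..<b} u
      \<le> ennreal (exp (- lam * u)) * (\<integral>\<^sup>+\<omega>. indicator (ball 0 r) (X u \<omega>) \<partial>M) * indicator {0..} u"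
    proof (cases "0 < u \<and> u < b")
      case True
      then have [measurable]: "random_variable borel (X u)"
        by (intro random_variable_levy) simp
      have "(\<integral>\<^sup>+\<omega>. indicator (ball 0 r) (X u \<omega>) \<partial>M) = (\<integral>\<^sup>+\<omega>. indicator {\<omega> \<in> space M. X u \<omega> \<in> ball 0 r} \<omega> \<partial>M)"
        by (rule nn_integral_cong) (auto simp: indicator_def)
      also have "\<dots> = ennreal (prob {\<omega> \<in> space M. X u \<omega> \<in> ball 0 r})"
        by (subst nn_integral_indicator) (simp_all only: emeasure_eq_measure, measurable)
      finally have "(\<integral>\<^sup>+\<omega>. indicator (ball 0 r) (X u \<omega>) \<partial>M) = ennreal (prob {\<omega> \<in> space M. X u \<omega> \<in> ball 0 r})" .
      moreover have "exp (- lam * b) * (1 / 2) \<le> exp (- lam * u) * prob {\<omega> \<in> space M. X u \<omega> \<in> ball 0 r}"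
        using True b(2)[of u] lam by (intro mult_mono) auto
      ultimately show ?thesis
        using True by (simp add: ennreal_mult'[symmetric] ennreal_leI del: mem_ball)
    qed simp
  qed
  also have "\<dots> = (\<integral>\<^sup>+z. indicator (ball 0 r) z \<partial>resolvent_measure lam)"
    by (rule nn_integral_resolvent_measure[symmetric]) simp
  finally show ?thesis by simp
qed

section \<open>Splitting the potential at a fixed time\<close>

lemma potential_eq:
  assumes [measurable]: "f \<in> borel_measurable borel"
  shows "potential lam f x
    = (\<integral>\<^sup>+\<omega>. (\<integral>\<^sup>+u\<in>{0..}. ennreal (exp (- lam * u)) * f (x + X u \<omega>) \<partial>lborel) \<partial>M)"
  unfolding potential_def by (rule nn_integral_resolvent_measure_swap) measurable

lemma potential_antimono:
  assumes "f \<in> borel_measurable borel" and "lam \<le> lam'"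
  shows "potential lam' f x \<le> potential lam f x"
  unfolding potential_eq[OF assms(1)]
proof (intro nn_integral_mono)
  fix \<omega> and u :: real
  have "exp (- lam' * u) \<le> exp (- lam * u)" if "0 \<le> u"
    using that assms(2) by (simp add: mult_right_mono)
  then show "ennreal (exp (- lam' * u)) * f (x + X u \<omega>) * indicator {0..} u
      \<le> ennreal (exp (- lam * u)) * f (x + X u \<omega>) * indicator {0..} u"
    by (auto simp: indicator_def intro!: mult_right_mono ennreal_leI)
qed

text \<open>With \<open>lam = 0\<close> this is the expectation in \<open>kato_time\<close>; with
  the discount of the potential it is the part of the potential collected up to time
  \<open>t\<close>.\<close>

definition killed_potential :: "real \<Rightarrow> real \<Rightarrow> (real \<Rightarrow> ennreal) \<Rightarrow> real \<Rightarrow> ennreal" where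
  "killed_potential lam t f x
    = (\<integral>\<^sup>+\<omega>. (\<integral>\<^sup>+u\<in>{0..t}. ennreal (exp (- lam * u)) * f (x + X u \<omega>) \<partial>lborel) \<partial>M)"

text \<open>The time integral is cut at \<open>t\<close>. The two closed pieces overlap in a null
  set only, and the Markov property turns the later piece into the potential at the position reached
  at time \<open>t\<close>.\<close>

lemma potential_split:
  assumes f[measurable]: "f \<in> borel_measurable borel" and t: "0 < t"
  shows "potential lam f x
    = killed_potential lam t f x + ennreal (exp (- lam * t)) * (\<integral>\<^sup>+\<omega>. potential lam f (x + X t \<omega>) \<partial>M)"
proof -
  let ?Y = cadlag_version
  have eqY: "AE \<omega> in M. (\<integral>\<^sup>+u\<in>S. ennreal (exp (- lam * u)) * f (x + X u \<omega>) \<partial>lborel)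
      = (\<integral>\<^sup>+u\<in>S. ennreal (exp (- lam * u)) * f (x + ?Y u \<omega>) \<partial>lborel)" if "S \<subseteq> {0..}" for S
    using AE_cadlag_version
    by eventually_elim (use that in \<open>auto intro!: nn_integral_cong simp: indicator_def\<close>)
  have "potential lam f x = (\<integral>\<^sup>+\<omega>. (\<integral>\<^sup>+u\<in>{0..}. ennreal (exp (- lam * u)) * f (x + ?Y u \<omega>) \<partial>lborel) \<partial>M)"
    unfolding potential_eq[OF f] by (rule nn_integral_cong_AE, rule eqY) simp
  also have "\<dots> = (\<integral>\<^sup>+\<omega>. (\<integral>\<^sup>+u\<in>{0..t}. ennreal (exp (- lam * u)) * f (x + ?Y u \<omega>) \<partial>lborel)
      + (\<integral>\<^sup>+u\<in>{t..}. ennreal (exp (- lam * u)) * f (x + ?Y u \<omega>) \<partial>lborel) \<partial>M)"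
  proof (rule nn_integral_cong)
    fix \<omega> assume [measurable]: "\<omega> \<in> space M"
    have "(\<integral>\<^sup>+u\<in>{0..}. ennreal (exp (- lam * u)) * f (x + ?Y u \<omega>) \<partial>lborel)
      = (\<integral>\<^sup>+u. ennreal (exp (- lam * u)) * f (x + ?Y u \<omega>) * indicator {0..t} u
          + ennreal (exp (- lam * u)) * f (x + ?Y u \<omega>) * indicator {t..} u \<partial>lborel)"
      by (rule nn_integral_cong_AE, use AE_lborel_singleton[of t] in eventually_elim)
         (use t in \<open>auto simp: indicator_def\<close>)
    then show "(\<integral>\<^sup>+u\<in>{0..}. ennreal (exp (- lam * u)) * f (x + ?Y u \<omega>) \<partial>lborel)
      = (\<integral>\<^sup>+u\<in>{0..t}. ennreal (exp (- lam * u)) * f (x + ?Y u \<omega>) \<partial>lborel)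
      + (\<integral>\<^sup>+u\<in>{t..}. ennreal (exp (- lam * u)) * f (x + ?Y u \<omega>) \<partial>lborel)"
      by (simp add: nn_integral_add)
  qed
  also have "\<dots> = (\<integral>\<^sup>+\<omega>. (\<integral>\<^sup>+u\<in>{0..t}. ennreal (exp (- lam * u)) * f (x + ?Y u \<omega>) \<partial>lborel) \<partial>M)
      + (\<integral>\<^sup>+\<omega>. (\<integral>\<^sup>+u\<in>{t..}. ennreal (exp (- lam * u)) * f (x + ?Y u \<omega>) \<partial>lborel) \<partial>M)"
    by (rule nn_integral_add) measurable
  also have "(\<integral>\<^sup>+\<omega>. (\<integral>\<^sup>+u\<in>{0..t}. ennreal (exp (- lam * u)) * f (x + ?Y u \<omega>) \<partial>lborel) \<partial>M) = killed_potential lam t f x"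
    unfolding killed_potential_def by (rule nn_integral_cong_AE[symmetric], rule eqY) simp
  also have "(\<integral>\<^sup>+\<omega>. (\<integral>\<^sup>+u\<in>{t..}. ennreal (exp (- lam * u)) * f (x + ?Y u \<omega>) \<partial>lborel) \<partial>M)
      = (\<integral>\<^sup>+\<omega>. (\<integral>\<^sup>+u\<in>{t..}. ennreal (exp (- lam * u)) * f (x + X u \<omega>) \<partial>lborel) \<partial>M)"
    by (rule nn_integral_cong_AE[symmetric], rule eqY) (use t in auto)
  \<comment> \<open>The grid consists of one step of length \<open>t\<close>, and the weight of the
    past is constantly 1.\<close>
  also have "\<dots> = ennreal (exp (- lam * t)) * (\<integral>\<^sup>+\<omega>. potential lam f (x + X t \<omega>) \<partial>M)"
    using resolvent_markov[of "\<lambda>_. 1" 1 "\<lambda>z. f (x + z)" t t lam] t by (simp add: potential_def add.assoc)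
  finally show ?thesis .
qed

text \<open>Both bounds are collected for a common radius and a common constant, which do not depend
  on \<open>f\<close>.\<close>

lemma potential_comparable:
  assumes lim: "(hitting_laplace M X lam \<longlongrightarrow> 1) (at 0)" and lam: "0 < lam"
  obtains \<delta> K where "0 < \<delta>" "\<delta> \<le> 1"
    "\<And>f x Q. f \<in> borel_measurable borel \<Longrightarrow> (\<And>w. (\<integral>\<^sup>+z\<in>ball w \<delta>. f z \<partial>lborel) \<le> Q)
      \<Longrightarrow> potential lam f x \<le> ennreal K * Q"
    "\<And>f x. f \<in> borel_measurable borel \<Longrightarrow> (\<integral>\<^sup>+z\<in>ball x \<delta>. f z \<partial>lborel) \<le> ennreal K * potential lam f x"
proof -
  obtain \<delta>' where \<delta>': "0 < \<delta>'"
    "\<And>f x y. f \<in> borel_measurable borel \<Longrightarrow> \<bar>y\<bar> < \<delta>' \<Longrightarrow> potential lam f (x + y) \<le> 2 * potential lam f x"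
    using potential_doubling[OF lim lam] by blast
  \<comment> \<open>The radius delivered in the end is \<open>\<delta> / 2\<close>, as the lower
    bound loses a factor 2; the cap makes it at most 1, so that its balls fit into unit
    balls.\<close>
  define \<delta> where "\<delta> = min \<delta>' 2"
  have \<delta>: "0 < \<delta>"
    "\<And>f x y. f \<in> borel_measurable borel \<Longrightarrow> \<bar>y\<bar> < \<delta> \<Longrightarrow> potential lam f (x + y) \<le> 2 * potential lam f x"
    using \<delta>' by (simp_all add: \<delta>_def)
  define c where "c = measure (resolvent_measure lam) (ball 0 (\<delta> / 2))"
  interpret R: finite_measure "resolvent_measure lam"
    using lam by (rule finite_measure_resolvent_measure)
  have c_eq: "emeasure (resolvent_measure lam) (ball 0 (\<delta> / 2)) = ennreal c"
    by (simp add: c_def R.emeasure_eq_measure)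
  then have c: "0 < c"
    using emeasure_resolvent_measure_ball_pos[OF lam, of "\<delta> / 2"] \<delta>(1) by simp
  define K where "K = max (1 / (\<delta> / 2 * lam)) (4 * \<delta> / c)"
  show ?thesis
  proof (rule that[of "\<delta> / 2" K])
    show "0 < \<delta> / 2" "\<delta> / 2 \<le> 1" using \<delta>(1) by (simp_all add: \<delta>_def)
  next
    fix f :: "real \<Rightarrow> ennreal" and x Q
    assume f: "f \<in> borel_measurable borel" and Q: "\<And>w. (\<integral>\<^sup>+z\<in>ball w (\<delta> / 2). f z \<partial>lborel) \<le> Q"
    have "potential lam f x \<le> ennreal (1 / (\<delta> / 2 * lam)) * Q"
      by (rule potential_upper[OF lam f _ \<delta>(2)[OF f] Q]) (use \<delta>(1) in auto)
    also have "\<dots> \<le> ennreal K * Q"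
      by (intro mult_right_mono ennreal_leI) (auto simp: K_def)
    finally show "potential lam f x \<le> ennreal K * Q" .
  next
    fix f :: "real \<Rightarrow> ennreal" and x
    assume f: "f \<in> borel_measurable borel"
    have "ennreal c * (\<integral>\<^sup>+z\<in>ball x (\<delta> / 2). f z \<partial>lborel) \<le> ennreal (4 * \<delta>) * potential lam f x"
      unfolding c_eq[symmetric] by (rule potential_lower[OF lam f \<delta>(1) \<delta>(2)[OF f]])
    then have "(\<integral>\<^sup>+z\<in>ball x (\<delta> / 2). f z \<partial>lborel) \<le> ennreal (4 * \<delta> / c) * potential lam f x"
      using c \<delta>(1) by (intro ennreal_le_divideI) auto
    also have "\<dots> \<le> ennreal K * potential lam f x"
      by (intro mult_right_mono ennreal_leI) (auto simp: K_def)
    finally show "(\<integral>\<^sup>+z\<in>ball x (\<delta> / 2). f z \<partial>lborel) \<le> ennreal K * potential lam f x" .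
  qed
qed

end

section \<open>Uniformly locally integrable functions\<close>

text \<open>The balls of radius \<open>\<delta>\<close> centred at
  \<open>x - 1 + real i * \<delta>\<close> with \<open>i < n\<close> cover the unit ball around
  \<open>x\<close>, and \<open>n\<close> depends on \<open>\<delta>\<close> alone.\<close>

lemma nn_integral_ball_1_le:
  assumes \<delta>: "0 < (\<delta> :: real)"
  obtains n :: nat where
    "\<And>f x S. f \<in> borel_measurable borel \<Longrightarrow> (\<And>w. (\<integral>\<^sup>+z\<in>ball w \<delta>. f z \<partial>lborel) \<le> S)
      \<Longrightarrow> (\<integral>\<^sup>+z\<in>ball (x :: real) 1. f z \<partial>lborel) \<le> of_nat n * S"
proof -
  obtain n where n: "2 / \<delta> < real n"
    using reals_Archimedean2 by blast
  show ?thesis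
  proof (rule that[of n])
    fix f :: "real \<Rightarrow> ennreal" and x S
    assume [measurable]: "f \<in> borel_measurable borel"
      and S: "\<And>w. (\<integral>\<^sup>+z\<in>ball w \<delta>. f z \<partial>lborel) \<le> S"
    let ?c = "\<lambda>i. x - 1 + real i * \<delta>"
    have "indicator (ball x 1) z \<le> (\<Sum>i<n. indicator (ball (?c i) \<delta>) z :: ennreal)" for z
    proof (cases "z \<in> ball x 1")
      case True
      then have z: "0 < z - x + 1" "z - x + 1 < 2"
        unfolding mem_ball dist_real_def by linarith+
      \<comment> \<open>This numbers the cell of length \<open>\<delta>\<close>, counted from
        \<open>x - 1\<close>, that contains \<open>z\<close>; each cell lies in the ball around its
        left end point.\<close>
      define i where "i = nat \<lfloor>(z - x + 1) / \<delta>\<rfloor>"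
      have i: "real i = real_of_int \<lfloor>(z - x + 1) / \<delta>\<rfloor>"
        using z \<delta> by (simp add: i_def)
      then have "real i \<le> (z - x + 1) / \<delta>" "(z - x + 1) / \<delta> < real i + 1"
        by linarith+
      then have 1: "real i * \<delta> \<le> z - x + 1" "z - x + 1 < real i * \<delta> + \<delta>"
        using \<delta> by (simp_all add: field_simps)
      have "real i * \<delta> < real n * \<delta>"
      proof (rule le_less_trans)
        show "real i * \<delta> \<le> 2" using 1 z by linarith
        show "2 < real n * \<delta>" using n \<delta> by (simp add: field_simps)
      qed
      then have "i < n" using \<delta> by simp
      moreover have "z \<in> ball (?c i) \<delta>"
        using 1 \<delta> unfolding mem_ball dist_real_def by linarith
      ultimately have "(1 :: ennreal) \<le> (\<Sum>i<n. indicator (ball (?c i) \<delta>) z)"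
        using member_le_sum[of i "{..<n}" "\<lambda>i. indicator (ball (?c i) \<delta>) z :: ennreal"]
        by (simp del: mem_ball sum.lessThan_Suc)
      then show ?thesis by (simp add: indicator_def)
    qed simp
    then have "(\<integral>\<^sup>+z\<in>ball x 1. f z \<partial>lborel) \<le> (\<integral>\<^sup>+z. (\<Sum>i<n. f z * indicator (ball (?c i) \<delta>) z) \<partial>lborel)"
      unfolding sum_distrib_left[symmetric] by (intro nn_integral_mono mult_left_mono) auto
    also have "\<dots> = (\<Sum>i<n. \<integral>\<^sup>+z\<in>ball (?c i) \<delta>. f z \<partial>lborel)"
      by (rule nn_integral_sum) measurable
    also have "\<dots> \<le> (\<Sum>i<n. S)"
      by (rule sum_mono) (rule S)
    finally show "(\<integral>\<^sup>+z\<in>ball x 1. f z \<partial>lborel) \<le> of_nat n * S" by simp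
  qed
qed

text \<open>This set and the next are the right-hand sides of the two identities to be proved; no
  process enters them.\<close>

definition unif_loc_null :: "(real \<Rightarrow> real) set" where
  "unif_loc_null = {q \<in> borel_measurable borel.
     ((\<lambda>r. SUP x::real. \<integral>\<^sup>+z\<in>ball x r. ennreal \<bar>q z\<bar> \<partial>lborel) \<longlongrightarrow> 0) (at_right 0)}"

definition unif_loc_finite :: "(real \<Rightarrow> real) set" where
  "unif_loc_finite = {q \<in> borel_measurable borel.
     (SUP x::real. \<integral>\<^sup>+z\<in>ball x 1. ennreal \<bar>q z\<bar> \<partial>lborel) < \<infinity>}"

lemma unif_loc_null_subset: "unif_loc_null \<subseteq> unif_loc_finite"
proof
  fix q assume q: "q \<in> unif_loc_null"
  let ?F = "\<lambda>r. SUP x::real. \<integral>\<^sup>+z\<in>ball x r. ennreal \<bar>q z\<bar> \<partial>lborel"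
  have [measurable]: "q \<in> borel_measurable borel" and lim: "(?F \<longlongrightarrow> 0) (at_right 0)"
    using q by (auto simp: unif_loc_null_def)
  have "\<forall>\<^sub>F r in at_right 0. ?F r < 1"
    using lim by (rule order_tendstoD) simp
  then obtain b where b: "0 < b" "\<And>r. 0 < r \<Longrightarrow> r < b \<Longrightarrow> ?F r < 1"
    by (auto simp: eventually_at_right_field)
  define r where "r = b / 2"
  have r: "0 < r" "?F r < 1"
    using b by (auto simp: r_def)
  have le1: "(\<integral>\<^sup>+z\<in>ball x r. ennreal \<bar>q z\<bar> \<partial>lborel) \<le> 1" for x
    using r(2) by (meson SUP_upper UNIV_I less_imp_le order_trans)
  obtain n :: nat where n: "\<And>f x S. f \<in> borel_measurable borel \<Longrightarrow>
      (\<And>w. (\<integral>\<^sup>+z\<in>ball w r. f z \<partial>lborel) \<le> S) \<Longrightarrow> (\<integral>\<^sup>+z\<in>ball (x :: real) 1. f z \<partial>lborel) \<le> of_nat n * S"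
    using nn_integral_ball_1_le[OF r(1)] by blast
  have "(SUP x::real. \<integral>\<^sup>+z\<in>ball x 1. ennreal \<bar>q z\<bar> \<partial>lborel) \<le> of_nat n * 1"
    by (intro SUP_least n le1) measurable
  also have "\<dots> < \<infinity>" by (simp add: of_nat_less_top)
  finally show "q \<in> unif_loc_finite"
    by (simp add: unif_loc_finite_def)
qed

text \<open>The witness has the value \<open>n\<close> on \<open>[n, n + 1 / n)\<close>: spikes of mass \<open>1\<close> and vanishing width.\<close>

lemma unif_loc_null_neq: "unif_loc_null \<noteq> unif_loc_finite"
proof -
  define q :: "real \<Rightarrow> real" where
    "q z = (if 1 \<le> \<lfloor>z\<rfloor> \<and> z - real_of_int \<lfloor>z\<rfloor> < 1 / real_of_int \<lfloor>z\<rfloor> then real_of_int \<lfloor>z\<rfloor> else 0)" for z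
  define g :: "int \<Rightarrow> real \<Rightarrow> ennreal" where
    "g n z = ennreal (real_of_int n) * indicator {real_of_int n..<real_of_int n + 1 / real_of_int n} z" for n z
  have q[measurable]: "q \<in> borel_measurable borel"
    unfolding q_def by measurable
  have [measurable]: "g n \<in> borel_measurable borel" for n
    unfolding g_def by measurable
  have g_int: "(\<integral>\<^sup>+z. g n z \<partial>lborel) = (if 1 \<le> n then 1 else 0)" for n
  proof (cases "1 \<le> n")
    case True
    then have "(\<integral>\<^sup>+z. g n z \<partial>lborel) = ennreal (real_of_int n) * ennreal (1 / real_of_int n)"
      unfolding g_def by (subst nn_integral_cmult_indicator) simp_all
    also have "\<dots> = 1"
      using True by (subst ennreal_mult[symmetric]) simp_all
    finally show ?thesis using True by simp
  qed (simp add: g_def ennreal_neg)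
  have q_le_g: "ennreal \<bar>q z\<bar> \<le> g \<lfloor>z\<rfloor> z" for z
    by (auto simp: q_def g_def indicator_def algebra_simps)
  have g_le_q: "g n z \<le> ennreal \<bar>q z\<bar>" if "1 \<le> n" for n z
  proof (cases "z \<in> {real_of_int n..<real_of_int n + 1 / real_of_int n}")
    case True
    \<comment> \<open>A spike of width at most 1 stays in one unit cell, on which the floor is
      \<open>n\<close>.\<close>
    have "1 / real_of_int n \<le> 1" using that by simp
    with True have "\<lfloor>z\<rfloor> = n"
      by (intro floor_unique) auto
    with True that show ?thesis
      by (auto simp: q_def g_def)
  qed (simp add: g_def)
  \<comment> \<open>A ball of radius 1 meets at most three unit cells, each carrying mass at most
    1.\<close>
  have "(\<integral>\<^sup>+z\<in>ball x 1. ennreal \<bar>q z\<bar> \<partial>lborel) \<le> 3" for x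
  proof -
    let ?N = "{\<lfloor>x\<rfloor> - 1, \<lfloor>x\<rfloor>, \<lfloor>x\<rfloor> + 1}"
    have "(\<integral>\<^sup>+z\<in>ball x 1. ennreal \<bar>q z\<bar> \<partial>lborel) \<le> (\<integral>\<^sup>+z. (\<Sum>n\<in>?N. g n z) \<partial>lborel)"
    proof (rule nn_integral_mono)
      fix z :: real
      show "ennreal \<bar>q z\<bar> * indicator (ball x 1) z \<le> (\<Sum>n\<in>?N. g n z)"
      proof (cases "z \<in> ball x 1")
        case True
        then have "x - 1 < z" "z < x + 1"
          unfolding mem_ball dist_real_def by linarith+
        then have "\<lfloor>z\<rfloor> = \<lfloor>x\<rfloor> - 1 \<or> \<lfloor>z\<rfloor> = \<lfloor>x\<rfloor> \<or> \<lfloor>z\<rfloor> = \<lfloor>x\<rfloor> + 1"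
          by linarith
        then have "\<lfloor>z\<rfloor> \<in> ?N" by auto
        have "ennreal \<bar>q z\<bar> \<le> g \<lfloor>z\<rfloor> z" by (rule q_le_g)
        also have "\<dots> \<le> (\<Sum>n\<in>?N. g n z)"
          by (rule member_le_sum[of "\<lfloor>z\<rfloor>" ?N "\<lambda>n. g n z"]) (use \<open>\<lfloor>z\<rfloor> \<in> ?N\<close> in auto)
        finally show ?thesis using True by (simp add: indicator_def)
      qed simp
    qed
    also have "\<dots> = (\<Sum>n\<in>?N. \<integral>\<^sup>+z. g n z \<partial>lborel)"
      by (rule nn_integral_sum) measurable
    also have "\<dots> \<le> (\<Sum>n\<in>?N. 1)"
      by (rule sum_mono) (simp add: g_int)
    also have "\<dots> = 3" by simp
    finally show ?thesis .
  qed
  then have "(SUP x::real. \<integral>\<^sup>+z\<in>ball x 1. ennreal \<bar>q z\<bar> \<partial>lborel) \<le> 3"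
    by (intro SUP_least)
  also have "(3 :: ennreal) < \<infinity>" by simp
  finally have "q \<in> unif_loc_finite"
    by (simp add: unif_loc_finite_def)
  moreover have "q \<notin> unif_loc_null"
  proof
    let ?F = "\<lambda>r. SUP x::real. \<integral>\<^sup>+z\<in>ball x r. ennreal \<bar>q z\<bar> \<partial>lborel"
    assume "q \<in> unif_loc_null"
    then have "(?F \<longlongrightarrow> 0) (at_right 0)"
      by (simp add: unif_loc_null_def)
    then have "\<forall>\<^sub>F r in at_right 0. ?F r < 1"
      by (rule order_tendstoD) simp
    then obtain b where b: "0 < b" "\<And>r. 0 < r \<Longrightarrow> r < b \<Longrightarrow> ?F r < 1"
      by (auto simp: eventually_at_right_field)
    define r where "r = b / 2"
    have r: "0 < r" "?F r < 1"
      using b by (auto simp: r_def)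
    \<comment> \<open>With \<open>1 / n < r\<close> the whole spike at \<open>n\<close> lies in the
      ball of radius \<open>r\<close> around \<open>n\<close>, so the supremum is at least 1 for
      every \<open>r\<close>.\<close>
    obtain n0 :: nat where "0 < n0" "1 / real n0 < r"
      using r(1) by (metis nat_approx_posE zero_less_Suc)
    define n where "n = int n0"
    have n: "1 \<le> n" "1 / real_of_int n < r"
      using \<open>0 < n0\<close> \<open>1 / real n0 < r\<close> by (auto simp: n_def)
    have "1 = (\<integral>\<^sup>+z. g n z \<partial>lborel)"
      using n(1) by (simp add: g_int)
    also have "\<dots> \<le> (\<integral>\<^sup>+z\<in>ball (real_of_int n) r. ennreal \<bar>q z\<bar> \<partial>lborel)"
    proof (rule nn_integral_mono)
      fix z
      show "g n z \<le> ennreal \<bar>q z\<bar> * indicator (ball (real_of_int n) r) z"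
      proof (cases "z \<in> ball (real_of_int n) r")
        case True
        then show ?thesis using g_le_q[OF n(1)] by simp
      next
        case False
        then have "z \<notin> {real_of_int n..<real_of_int n + 1 / real_of_int n}"
          using n(2) r(1) by (auto simp: dist_real_def)
        then show ?thesis by (simp add: g_def)
      qed
    qed
    also have "\<dots> \<le> ?F r" by (rule SUP_upper) simp
    finally show False using r(2) by simp
  qed
  ultimately show ?thesis by blast
qed

section \<open>The two Kato classes\<close>

context levy_process
begin

section \<open>Localization in space\<close>

definition localized :: "(real \<Rightarrow> real) \<Rightarrow> real \<Rightarrow> real \<Rightarrow> real \<Rightarrow> ennreal" where
  "localized q x r z = ennreal \<bar>q z\<bar> * indicator (ball x r) z"

lemma measurable_localized [measurable]:
  assumes [measurable]: "q \<in> borel_measurable borel"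
  shows "localized q x r \<in> borel_measurable borel"
  unfolding localized_def by measurable

lemma kato_space_eq:
  "kato_space M X = {q \<in> borel_measurable borel. \<exists>lam>0.
     ((\<lambda>r. SUP x. potential lam (localized q x r) x) \<longlongrightarrow> 0) (at_right 0)}"
proof -
  have "(\<integral>\<^sup>+\<omega>. (\<integral>\<^sup>+u\<in>{0..}. ennreal (exp (- lam * u) * indicator (ball x r) (x + X u \<omega>)
            * \<bar>q (x + X u \<omega>)\<bar>) \<partial>lborel) \<partial>M) = potential lam (localized q x r) x"
    if [measurable]: "q \<in> borel_measurable borel" for q lam x r
    by (subst potential_eq, measurable)
       (auto intro!: nn_integral_cong simp: localized_def ennreal_mult' indicator_def)
  then show ?thesis
    unfolding kato_space_def by (intro Collect_cong conj_cong refl) simp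
qed

text \<open>A function vanishing outside \<open>ball x r\<close> has no larger integral over any
  other ball, so its integral over \<open>ball x r\<close> serves as \<open>Q\<close> at every
  centre.\<close>

lemma unif_loc_null_subset_kato_space:
  assumes lim: "(hitting_laplace M X lam \<longlongrightarrow> 1) (at 0)" and lam: "0 < lam"
  shows "unif_loc_null \<subseteq> kato_space M X"
proof
  fix q assume q: "q \<in> unif_loc_null"
  then have [measurable]: "q \<in> borel_measurable borel"
    and q0: "((\<lambda>r. SUP x::real. \<integral>\<^sup>+z\<in>ball x r. ennreal \<bar>q z\<bar> \<partial>lborel) \<longlongrightarrow> 0) (at_right 0)"
    by (auto simp: unif_loc_null_def)
  obtain \<delta> K where K: "\<And>f x Q. f \<in> borel_measurable borel \<Longrightarrow>
      (\<And>w. (\<integral>\<^sup>+z\<in>ball w \<delta>. f z \<partial>lborel) \<le> Q) \<Longrightarrow> potential lam f x \<le> ennreal K * Q"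
    using potential_comparable[OF lim lam] by metis
  have "(SUP x. potential lam (localized q x r) x)
      \<le> ennreal K * (SUP x::real. \<integral>\<^sup>+z\<in>ball x r. ennreal \<bar>q z\<bar> \<partial>lborel)" for r
  proof (rule SUP_least)
    fix x :: real
    have "potential lam (localized q x r) x \<le> ennreal K * (\<integral>\<^sup>+z\<in>ball x r. ennreal \<bar>q z\<bar> \<partial>lborel)"
      by (rule K) (auto intro!: nn_integral_mono simp: localized_def indicator_def)
    also have "\<dots> \<le> ennreal K * (SUP x::real. \<integral>\<^sup>+z\<in>ball x r. ennreal \<bar>q z\<bar> \<partial>lborel)"
      by (intro mult_left_mono SUP_upper) auto
    finally show "potential lam (localized q x r) x
      \<le> ennreal K * (SUP x::real. \<integral>\<^sup>+z\<in>ball x r. ennreal \<bar>q z\<bar> \<partial>lborel)" .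
  qed
  then have "((\<lambda>r. SUP x. potential lam (localized q x r) x) \<longlongrightarrow> 0) (at_right 0)"
    by (intro tendsto_0_le_cmult_ennreal[OF q0, where K = K] always_eventually allI)
  then show "q \<in> kato_space M X"
    using lam by (auto simp: kato_space_eq)
qed

text \<open>Membership provides some \<open>lam'\<close> unrelated to \<open>lam\<close>. A multiple
  \<open>real m * lam\<close> above \<open>lam'\<close> has the smaller potential, and its hitting
  transform still tends to 1.\<close>

lemma kato_space_subset_unif_loc_null:
  assumes lim: "(hitting_laplace M X lam \<longlongrightarrow> 1) (at 0)" and lam: "0 < lam"
  shows "kato_space M X \<subseteq> unif_loc_null"
proof
  fix q assume "q \<in> kato_space M X"
  then obtain lam' where [measurable]: "q \<in> borel_measurable borel"
    and q0: "((\<lambda>r. SUP x. potential lam' (localized q x r) x) \<longlongrightarrow> 0) (at_right 0)"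
    by (auto simp: kato_space_eq)
  obtain m :: nat where "max 0 (lam' / lam) < real m"
    using reals_Archimedean2 by blast
  then have m: "0 < m" "lam' \<le> real m * lam"
    using lam by (auto simp: field_simps)
  obtain \<delta> K where \<delta>: "0 < \<delta>" and K: "\<And>f x. f \<in> borel_measurable borel \<Longrightarrow>
      (\<integral>\<^sup>+z\<in>ball x \<delta>. f z \<partial>lborel) \<le> ennreal K * potential (real m * lam) f x"
    using potential_comparable[OF hitting_laplace_mult_tendsto_1[OF lim lam m(1)]] lam m(1)
    by (metis mult_pos_pos of_nat_0_less_iff)
  have "(SUP x::real. \<integral>\<^sup>+z\<in>ball x r. ennreal \<bar>q z\<bar> \<partial>lborel)
      \<le> ennreal K * (SUP x. potential lam' (localized q x r) x)" if r: "r < \<delta>" for r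
  proof (rule SUP_least)
    fix x :: real
    have "(\<integral>\<^sup>+z\<in>ball x r. ennreal \<bar>q z\<bar> \<partial>lborel) = (\<integral>\<^sup>+z\<in>ball x \<delta>. localized q x r z \<partial>lborel)"
      using r by (intro nn_integral_cong) (auto simp: localized_def indicator_def)
    also have "\<dots> \<le> ennreal K * potential (real m * lam) (localized q x r) x"
      by (rule K) measurable
    also have "\<dots> \<le> ennreal K * potential lam' (localized q x r) x"
      by (intro mult_left_mono potential_antimono m(2)) auto
    also have "\<dots> \<le> ennreal K * (SUP x. potential lam' (localized q x r) x)"
      by (intro mult_left_mono SUP_upper) auto
    finally show "(\<integral>\<^sup>+z\<in>ball x r. ennreal \<bar>q z\<bar> \<partial>lborel)
      \<le> ennreal K * (SUP x. potential lam' (localized q x r) x)" .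
  qed
  moreover have "\<forall>\<^sub>F r in at_right 0. r < \<delta>"
    using \<delta> by (auto simp: eventually_at_right_field)
  ultimately have "((\<lambda>r. SUP x::real. \<integral>\<^sup>+z\<in>ball x r. ennreal \<bar>q z\<bar> \<partial>lborel) \<longlongrightarrow> 0) (at_right 0)"
    by (intro tendsto_0_le_cmult_ennreal[OF q0, where K = K]) (rule eventually_mono)
  then show "q \<in> unif_loc_null"
    by (simp add: unif_loc_null_def)
qed

section \<open>Localization in time\<close>

lemma kato_time_eq:
  "kato_time M X = {q \<in> borel_measurable borel.
     ((\<lambda>t. SUP x. killed_potential 0 t (\<lambda>z. ennreal \<bar>q z\<bar>) x) \<longlongrightarrow> 0) (at_right 0)}"
  by (simp add: kato_time_def killed_potential_def)

lemma killed_potential_le: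
  assumes "0 < lam"
  shows "killed_potential lam t f x \<le> killed_potential 0 t f x"
  unfolding killed_potential_def
proof (intro nn_integral_mono)
  fix \<omega> and u :: real
  show "ennreal (exp (- lam * u)) * f (x + X u \<omega>) * indicator {0..t} u
      \<le> ennreal (exp (- 0 * u)) * f (x + X u \<omega>) * indicator {0..t} u"
  proof (cases "u \<in> {0..t}")
    case True
    then have "ennreal (exp (- lam * u)) * f (x + X u \<omega>) \<le> ennreal (exp (- 0 * u)) * f (x + X u \<omega>)"
      using assms by (intro mult_right_mono ennreal_leI) auto
    with True show ?thesis by simp
  qed simp
qed

text \<open>For \<open>u\<close> in \<open>{0..t}\<close> the discount is at least
  \<open>exp (- lam * t)\<close>. Together with \<open>killed_potential_le\<close> this lets the
  discount be introduced and removed up to a factor that tends to 1 with \<open>t\<close>.\<close>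

lemma killed_potential_0_le:
  assumes [measurable]: "f \<in> borel_measurable borel" and "0 < lam"
  shows "killed_potential 0 t f x \<le> ennreal (exp (lam * t)) * killed_potential lam t f x"
proof -
  let ?Y = cadlag_version
  have eqY: "killed_potential lam t f x
      = (\<integral>\<^sup>+\<omega>. (\<integral>\<^sup>+u\<in>{0..t}. ennreal (exp (- lam * u)) * f (x + ?Y u \<omega>) \<partial>lborel) \<partial>M)" for lam
    unfolding killed_potential_def
    by (rule nn_integral_cong_AE, use AE_cadlag_version in eventually_elim)
       (auto intro!: nn_integral_cong simp: indicator_def)
  have "killed_potential 0 t f x \<le> (\<integral>\<^sup>+\<omega>. (\<integral>\<^sup>+u. ennreal (exp (lam * t))
      * (ennreal (exp (- lam * u)) * f (x + ?Y u \<omega>) * indicator {0..t} u) \<partial>lborel) \<partial>M)"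
    unfolding eqY
  proof (intro nn_integral_mono)
    fix \<omega> and u :: real
    show "ennreal (exp (- 0 * u)) * f (x + ?Y u \<omega>) * indicator {0..t} u
      \<le> ennreal (exp (lam * t)) * (ennreal (exp (- lam * u)) * f (x + ?Y u \<omega>) * indicator {0..t} u)"
    proof (cases "u \<in> {0..t}")
      case True
      then have "1 \<le> exp (lam * t) * exp (- lam * u)"
        using assms(2) by (simp add: exp_add[symmetric])
      then have "1 * f (x + ?Y u \<omega>) \<le> ennreal (exp (lam * t) * exp (- lam * u)) * f (x + ?Y u \<omega>)"
        by (intro mult_right_mono) (simp_all add: ennreal_leI[of 1, simplified])
      with True show ?thesis
        by (simp add: ennreal_mult mult.assoc)
    qed simp
  qed
  also have "\<dots> = (\<integral>\<^sup>+\<omega>. ennreal (exp (lam * t))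
      * (\<integral>\<^sup>+u\<in>{0..t}. ennreal (exp (- lam * u)) * f (x + ?Y u \<omega>) \<partial>lborel) \<partial>M)"
    by (intro nn_integral_cong nn_integral_cmult) measurable
  also have "\<dots> = ennreal (exp (lam * t)) * killed_potential lam t f x"
    unfolding eqY by (rule nn_integral_cmult) measurable
  finally show ?thesis .
qed

text \<open>The potential of \<open>f\<close> is bounded by some \<open>S\<close>. At a small time
  the process is near its start with probability close to 1, and the Harnack inequality shows that
  most of the potential is still to come. In \<open>potential_split\<close> this leaves at most
  \<open>(1 - p t) * S\<close> for the part before \<open>t\<close>.\<close>

lemma unif_loc_finite_subset_kato_time:
  assumes lim: "(hitting_laplace M X lam \<longlongrightarrow> 1) (at 0)" and lam: "0 < lam"
  shows "unif_loc_finite \<subseteq> kato_time M X"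
proof
  fix q assume "q \<in> unif_loc_finite"
  then have q[measurable]: "q \<in> borel_measurable borel"
    and Q: "(SUP x::real. \<integral>\<^sup>+z\<in>ball x 1. ennreal \<bar>q z\<bar> \<partial>lborel) < \<infinity>" (is "?Q < _")
    by (auto simp: unif_loc_finite_def)
  define f where "f z = ennreal \<bar>q z\<bar>" for z
  have f[measurable]: "f \<in> borel_measurable borel"
    unfolding f_def by measurable
  obtain \<delta> K where \<delta>: "\<delta> \<le> 1" and K: "\<And>f x Q. f \<in> borel_measurable borel \<Longrightarrow>
      (\<And>w. (\<integral>\<^sup>+z\<in>ball w \<delta>. f z \<partial>lborel) \<le> Q) \<Longrightarrow> potential lam f x \<le> ennreal K * Q"
    using potential_comparable[OF lim lam] by metis
  have ball_Q: "(\<integral>\<^sup>+z\<in>ball w \<delta>. f z \<partial>lborel) \<le> ?Q" for w :: real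
  proof -
    have "(\<integral>\<^sup>+z\<in>ball w \<delta>. f z \<partial>lborel) \<le> (\<integral>\<^sup>+z\<in>ball w 1. ennreal \<bar>q z\<bar> \<partial>lborel)"
      using \<delta> by (intro nn_integral_mono) (simp add: f_def indicator_def)
    also have "\<dots> \<le> ?Q" by (rule SUP_upper) simp
    finally show ?thesis .
  qed
  have "ennreal K * ?Q < \<top>"
    using Q by (simp add: ennreal_mult_less_top)
  then obtain S where S: "ennreal K * ?Q = ennreal S" "0 \<le> S"
    by (cases "ennreal K * ?Q") auto
  have pot_S: "potential lam f x \<le> ennreal S" for x
    unfolding S(1)[symmetric] by (rule K[OF f ball_Q])
  have "((\<lambda>t. SUP x. killed_potential 0 t f x) \<longlongrightarrow> 0) (at_right 0)"
  proof (rule ennreal_tendsto_0I)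
    fix \<epsilon> :: real assume \<epsilon>: "0 < \<epsilon>"
    \<comment> \<open>The choice gives \<open>2 * \<eta> * S \<le> \<epsilon>\<close>;
      \<open>S + 1\<close> avoids division by 0, and \<open>min 1\<close> keeps
      \<open>1 - \<eta>\<close> nonnegative. The factor 2 is slack:
      \<open>exp (lam * t) * (1 - p t)\<close> tends to \<open>\<eta>\<close> and is eventually
      below \<open>2 * \<eta>\<close>.\<close>
    define \<eta> where "\<eta> = min 1 (\<epsilon> / (2 * (S + 1)))"
    have \<eta>: "0 < \<eta>" "\<eta> \<le> 1" "2 * \<eta> * S \<le> \<epsilon>"
    proof -
      show "0 < \<eta>" "\<eta> \<le> 1" using \<epsilon> S(2) by (simp_all add: \<eta>_def)
      have "2 * \<eta> * S \<le> 2 * \<eta> * (S + 1)"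
        using \<open>0 < \<eta>\<close> by simp
      also have "\<dots> \<le> 2 * (\<epsilon> / (2 * (S + 1))) * (S + 1)"
        using S(2) by (intro mult_right_mono mult_left_mono) (auto simp: \<eta>_def)
      also have "\<dots> = \<epsilon>" using S(2) by (simp add: field_simps)
      finally show "2 * \<eta> * S \<le> \<epsilon>" .
    qed
    obtain d where d: "0 < d" and harnack: "\<And>f x y. f \<in> borel_measurable borel \<Longrightarrow> \<bar>y\<bar> < d \<Longrightarrow>
        ennreal (1 - \<eta>) * potential lam f (x + y) \<le> potential lam f x"
      using potential_harnack[OF lim lam, of "1 - \<eta>"] \<eta>(1) by auto
    define P where "P t = prob {\<omega> \<in> space M. X t \<omega> \<in> ball 0 d}" for t
    define p where "p t = exp (- lam * t) * ((1 - \<eta>) * P t)" for t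
    have bound: "killed_potential 0 t f x \<le> ennreal (exp (lam * t) * (1 - p t)) * ennreal S"
      if t: "0 < t" and p1: "p t \<le> 1" for t x
    proof -
      have [measurable]: "random_variable borel (X t)"
        using t by (intro random_variable_levy) simp
      note measurable_potential[OF lam, measurable]
      have "ennreal ((1 - \<eta>) * P t) * potential lam f x
          = (\<integral>\<^sup>+\<omega>. ennreal (1 - \<eta>) * potential lam f x * indicator {\<omega> \<in> space M. X t \<omega> \<in> ball 0 d} \<omega> \<partial>M)"
        using \<eta>(2) unfolding P_def
        by (subst nn_integral_cmult_indicator)
           (measurable, simp add: emeasure_eq_measure ennreal_mult ac_simps del: mem_ball)
      \<comment> \<open>On the event, the Harnack inequality is used at
        \<open>x + X t \<omega>\<close> with the shift \<open>- X t \<omega>\<close> leading back to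
        \<open>x\<close>.\<close>
      also have "\<dots> \<le> (\<integral>\<^sup>+\<omega>. potential lam f (x + X t \<omega>) \<partial>M)"
      proof (rule nn_integral_mono)
        fix \<omega>
        show "ennreal (1 - \<eta>) * potential lam f x * indicator {\<omega> \<in> space M. X t \<omega> \<in> ball 0 d} \<omega>
          \<le> potential lam f (x + X t \<omega>)"
          using harnack[OF f, of "- X t \<omega>" "x + X t \<omega>"] by (simp add: indicator_def dist_real_def)
      qed
      finally have "ennreal (exp (- lam * t)) * (ennreal ((1 - \<eta>) * P t) * potential lam f x)
          \<le> ennreal (exp (- lam * t)) * (\<integral>\<^sup>+\<omega>. potential lam f (x + X t \<omega>) \<partial>M)"
        by (intro mult_left_mono) auto
      then have "killed_potential lam t f x + ennreal (p t) * potential lam f x \<le> potential lam f x"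
        unfolding p_def potential_split[OF f t, of lam x, symmetric]
        by (subst (2) potential_split[OF f t]) (simp add: ennreal_mult' mult.assoc add_left_mono)
      then have "killed_potential lam t f x \<le> ennreal (1 - p t) * potential lam f x"
      proof (rule ennreal_absorb_le)
        show "potential lam f x < \<top>"
          using pot_S[of x] by (rule le_less_trans) simp
        show "0 \<le> p t" using \<eta>(2) by (simp add: p_def P_def)
      qed
      also have "\<dots> \<le> ennreal (1 - p t) * ennreal S"
        by (intro mult_left_mono pot_S) simp
      finally have "ennreal (exp (lam * t)) * killed_potential lam t f x
          \<le> ennreal (exp (lam * t)) * (ennreal (1 - p t) * ennreal S)"
        by (intro mult_left_mono) auto
      with killed_potential_0_le[OF f lam, of t x]
      have "killed_potential 0 t f x \<le> ennreal (exp (lam * t)) * (ennreal (1 - p t) * ennreal S)"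
        by (rule order_trans)
      also have "\<dots> = ennreal (exp (lam * t) * (1 - p t)) * ennreal S"
        using p1 by (simp add: ennreal_mult mult.assoc)
      finally show ?thesis .
    qed
    have P_lim: "(P \<longlongrightarrow> 1) (at_right 0)"
      unfolding P_def using d by (rule prob_near_start_tendsto)
    have "(p \<longlongrightarrow> exp (- lam * 0) * ((1 - \<eta>) * 1)) (at_right 0)"
      unfolding p_def by (intro tendsto_intros P_lim)
    then have p_lim: "(p \<longlongrightarrow> 1 - \<eta>) (at_right 0)" by simp
    have "((\<lambda>t. exp (lam * t) * (1 - p t)) \<longlongrightarrow> exp (lam * 0) * (1 - (1 - \<eta>))) (at_right 0)"
      by (intro tendsto_intros p_lim)
    then have "\<forall>\<^sub>F t in at_right 0. exp (lam * t) * (1 - p t) < 2 * \<eta>"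
      by (rule order_tendstoD) (use \<eta> in simp)
    moreover have "\<forall>\<^sub>F t in at_right 0. p t < 1"
      using p_lim by (rule order_tendstoD) (use \<eta> in simp)
    moreover have "\<forall>\<^sub>F t in at_right 0. (0::real) < t"
      by (simp add: eventually_at_filter)
    ultimately show "\<forall>\<^sub>F t in at_right 0. (SUP x. killed_potential 0 t f x) \<le> ennreal \<epsilon>"
    proof eventually_elim
      case (elim t)
      show ?case
      proof (rule SUP_least)
        fix x
        have "killed_potential 0 t f x \<le> ennreal (exp (lam * t) * (1 - p t)) * ennreal S"
          using elim by (intro bound) auto
        also have "\<dots> \<le> ennreal (2 * \<eta>) * ennreal S"
          using elim by (intro mult_right_mono ennreal_leI) auto
        also have "\<dots> = ennreal (2 * \<eta> * S)"
          using \<eta> S(2) by (simp add: ennreal_mult)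
        also have "\<dots> \<le> ennreal \<epsilon>"
          using \<eta>(3) by (rule ennreal_leI)
        finally show "killed_potential 0 t f x \<le> ennreal \<epsilon>" .
      qed
    qed
  qed
  then show "q \<in> kato_time M X"
    unfolding f_def by (simp add: kato_time_eq)
qed

text \<open>For a suitable \<open>t\<close> the part before \<open>t\<close> is at most 1 at every
  start. Splitting at \<open>t\<close> then gives \<open>G \<le> 1 + a * G\<close> for the supremum
  \<open>G\<close> of the potential, with \<open>a < 1\<close>, and a bounded potential forces
  bounded ball integrals.\<close>

lemma kato_time_subset_unif_loc_finite:
  assumes lim: "(hitting_laplace M X lam \<longlongrightarrow> 1) (at 0)" and lam: "0 < lam"
  shows "kato_time M X \<subseteq> unif_loc_finite"
proof
  fix q assume "q \<in> kato_time M X"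
  then have q[measurable]: "q \<in> borel_measurable borel"
    and q0: "((\<lambda>t. SUP x. killed_potential 0 t (\<lambda>z. ennreal \<bar>q z\<bar>) x) \<longlongrightarrow> 0) (at_right 0)"
    by (auto simp: kato_time_eq)
  obtain \<delta> K where \<delta>: "0 < \<delta>" and K: "\<And>f x. f \<in> borel_measurable borel \<Longrightarrow>
      (\<integral>\<^sup>+z\<in>ball x \<delta>. f z \<partial>lborel) \<le> ennreal K * potential lam f x"
    using potential_comparable[OF lim lam] by metis
  have "\<forall>\<^sub>F t in at_right 0. (SUP x. killed_potential 0 t (\<lambda>z. ennreal \<bar>q z\<bar>) x) < 1"
    using q0 by (rule order_tendstoD) simp
  then obtain b where b: "0 < b"
    "\<And>t. 0 < t \<Longrightarrow> t < b \<Longrightarrow> (SUP x. killed_potential 0 t (\<lambda>z. ennreal \<bar>q z\<bar>) x) < 1"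
    by (auto simp: eventually_at_right_field)
  define t where "t = b / 2"
  have t: "0 < t" "(SUP x. killed_potential 0 t (\<lambda>z. ennreal \<bar>q z\<bar>) x) < 1"
    using b by (auto simp: t_def)
  define a where "a = exp (- lam * t)"
  have a: "0 < a" "a < 1"
    using lam t(1) by (auto simp: a_def)
  \<comment> \<open>Truncation makes the supremum of the potential finite, without which
    \<open>G \<le> 1 + a * G\<close> could not be solved for \<open>G\<close>; the resulting bound
    does not depend on \<open>n\<close>.\<close>
  define f where "f n z = min (ennreal \<bar>q z\<bar>) (of_nat n)" for n :: nat and z
  have f[measurable]: "f n \<in> borel_measurable borel" for n
    unfolding f_def by measurable
  have pot_f: "potential lam (f n) x \<le> ennreal (1 / (1 - a))" for n x
  proof -
    define G where "G = (SUP x. potential lam (f n) x)"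
    have "G \<le> of_nat n * ennreal (1 / lam)"
      unfolding G_def
    proof (rule SUP_least)
      fix x
      have "potential lam (f n) x \<le> (\<integral>\<^sup>+z. of_nat n \<partial>resolvent_measure lam)"
        unfolding potential_def by (intro nn_integral_mono) (simp add: f_def)
      then show "potential lam (f n) x \<le> of_nat n * ennreal (1 / lam)"
        by (simp add: emeasure_resolvent_measure_UNIV lam)
    qed
    also have "\<dots> < \<top>"
      by (simp add: ennreal_mult_less_top of_nat_less_top)
    finally obtain g where g: "G = ennreal g" "0 \<le> g"
      by (cases G) auto
    have "G \<le> 1 + ennreal a * G"
      unfolding G_def
    proof (rule SUP_least)
      fix x
      have "killed_potential lam t (f n) x \<le> killed_potential 0 t (f n) x"
        by (rule killed_potential_le[OF lam])
      also have "\<dots> \<le> killed_potential 0 t (\<lambda>z. ennreal \<bar>q z\<bar>) x"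
        unfolding killed_potential_def
        by (intro nn_integral_mono mult_right_mono mult_left_mono) (simp_all add: f_def)
      also have "\<dots> \<le> (SUP x. killed_potential 0 t (\<lambda>z. ennreal \<bar>q z\<bar>) x)"
        by (rule SUP_upper) simp
      finally have 1: "killed_potential lam t (f n) x \<le> 1"
        using t(2) by simp
      have "(\<integral>\<^sup>+\<omega>. potential lam (f n) (x + X t \<omega>) \<partial>M) \<le> (\<integral>\<^sup>+\<omega>. (SUP x. potential lam (f n) x) \<partial>M)"
        by (intro nn_integral_mono SUP_upper) simp
      then have 2: "(\<integral>\<^sup>+\<omega>. potential lam (f n) (x + X t \<omega>) \<partial>M) \<le> (SUP x. potential lam (f n) x)"
        by (simp add: emeasure_space_1)
      show "potential lam (f n) x \<le> 1 + ennreal a * (SUP x. potential lam (f n) x)"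
        unfolding potential_split[OF f t(1), of lam n x] a_def
        by (intro add_mono mult_left_mono 1 2) simp
    qed
    then have "ennreal g \<le> ennreal (1 + a * g)"
      using a g by (simp add: ennreal_mult)
    then have "g \<le> 1 + a * g"
      using a g by (subst (asm) ennreal_le_iff) auto
    then have "g \<le> 1 / (1 - a)"
      using a by (simp add: field_simps)
    have "potential lam (f n) x \<le> G"
      unfolding G_def by (rule SUP_upper) simp
    also have "\<dots> \<le> ennreal (1 / (1 - a))"
      unfolding g(1) using \<open>g \<le> 1 / (1 - a)\<close> by (rule ennreal_leI)
    finally show ?thesis .
  qed
  have SUP_f: "(SUP n. f n z) = ennreal \<bar>q z\<bar>" for z
  proof (rule antisym)
    show "(SUP n. f n z) \<le> ennreal \<bar>q z\<bar>"
      by (rule SUP_least) (simp add: f_def)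
    obtain n :: nat where "\<bar>q z\<bar> \<le> real n"
      using real_arch_simple by blast
    then have "ennreal \<bar>q z\<bar> \<le> of_nat n"
      unfolding ennreal_of_nat_eq_real_of_nat by (rule ennreal_leI)
    then have "ennreal \<bar>q z\<bar> = f n z" by (simp add: f_def min_def)
    also have "\<dots> \<le> (SUP n. f n z)" by (rule SUP_upper) simp
    finally show "ennreal \<bar>q z\<bar> \<le> (SUP n. f n z)" .
  qed
  \<comment> \<open>The bound being uniform in \<open>n\<close>, monotone convergence carries it
    from the truncations to \<open>q\<close>.\<close>
  have ball_\<delta>: "(\<integral>\<^sup>+z\<in>ball x \<delta>. ennreal \<bar>q z\<bar> \<partial>lborel) \<le> ennreal K * ennreal (1 / (1 - a))" for x
  proof -
    have "(\<integral>\<^sup>+z\<in>ball x \<delta>. ennreal \<bar>q z\<bar> \<partial>lborel) = (\<integral>\<^sup>+z. (SUP n. f n z * indicator (ball x \<delta>) z) \<partial>lborel)"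
      by (simp only: SUP_f[symmetric] SUP_mult_right_ennreal)
    also have "\<dots> = (SUP n. \<integral>\<^sup>+z\<in>ball x \<delta>. f n z \<partial>lborel)"
    proof (rule nn_integral_monotone_convergence_SUP)
      show "incseq (\<lambda>n z. f n z * indicator (ball x \<delta>) z)"
        by (intro incseq_SucI le_funI mult_right_mono) (auto simp: f_def intro: min.coboundedI2 order_trans)
    qed measurable
    also have "\<dots> \<le> ennreal K * ennreal (1 / (1 - a))"
      by (intro SUP_least order_trans[OF K[OF f]] mult_left_mono pot_f) simp
    finally show ?thesis .
  qed
  obtain n :: nat where n: "\<And>f x S. f \<in> borel_measurable borel \<Longrightarrow>
      (\<And>w. (\<integral>\<^sup>+z\<in>ball w \<delta>. f z \<partial>lborel) \<le> S) \<Longrightarrow> (\<integral>\<^sup>+z\<in>ball (x :: real) 1. f z \<partial>lborel) \<le> of_nat n * S"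
    using nn_integral_ball_1_le[OF \<delta>] by blast
  have "(SUP x::real. \<integral>\<^sup>+z\<in>ball x 1. ennreal \<bar>q z\<bar> \<partial>lborel) \<le> of_nat n * (ennreal K * ennreal (1 / (1 - a)))"
    by (intro SUP_least n ball_\<delta>) measurable
  also have "\<dots> < \<infinity>"
    by (simp add: ennreal_mult_less_top of_nat_less_top)
  finally show "q \<in> unif_loc_finite"
    by (simp add: unif_loc_finite_def)
qed

end

theorem theorem4p6:
  fixes M :: "'a measure" and X :: "real \<Rightarrow> 'a \<Rightarrow> real" and lam :: real
  assumes "levy_process M X"
    and "\<not> compound_poisson M X"
    and "0 < lam"
    and "hitting_laplace M X lam 0 = 1"
    and "(hitting_laplace M X lam \<longlongrightarrow> 1) (at 0)"
  shows "kato_space M X \<subset> kato_time M X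
    \<and> kato_space M X = {q \<in> borel_measurable borel.
          ((\<lambda>r. SUP x::real. \<integral>\<^sup>+z\<in>ball x r. ennreal \<bar>q z\<bar> \<partial>lborel) \<longlongrightarrow> 0) (at_right 0)}
    \<and> kato_time M X = {q \<in> borel_measurable borel.
          (SUP x::real. \<integral>\<^sup>+z\<in>ball x 1. ennreal \<bar>q z\<bar> \<partial>lborel) < \<infinity>}"
proof -
  interpret levy_process M X by fact
  have "kato_space M X = unif_loc_null"
    using kato_space_subset_unif_loc_null unif_loc_null_subset_kato_space assms(3,5) by blast
  moreover have "kato_time M X = unif_loc_finite"
    using kato_time_subset_unif_loc_finite unif_loc_finite_subset_kato_time assms(3,5) by blast
  \<comment> \<open>With both classes identified, strict inclusion is a statement about Lebesgue
    integrals, settled by the covering argument and the spikes.\<close>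
  ultimately show ?thesis
    using unif_loc_null_subset unif_loc_null_neq
    unfolding unif_loc_null_def[symmetric] unif_loc_finite_def[symmetric] by blast
qed

end
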